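(* Let $P\colon \mathcal{E}\to\mathcal{B}$ be a bifibration between small categories and let $D$ be a natural system in $\mathcal{B}$ with an endopairing $\mu\colon (D;D)\to D$. Let $P^*\colon \mathrm{H}^*(\mathcal{B};D)\to \mathrm{H}^*(\mathcal{E};P^*D)$ be the morphism induced by $P$ in Baues--Wirsching cohomology. Then the cup-length of $\ker P^*$ is a lower bound for the Švarc genus of $P$: $$\mathrm{c.p.l}(\ker P^* )\le \mathrm{Sg}(P).$$
   Context: All categories are small. Factorization category. $\mathcal{F}\mathcal{C}$ has as objects the morphisms of $\mathcal{C}$; a morphism $(\alpha,\beta)\colon\lambda\to\mu$ from $\lambda\colon A\to B$ to $\mu\colon C\to D$ is a pair $\alpha\colon B\to D$, $\beta\colon C\to A$ with $\mu=\alpha\circ\lambda\circ\beta$; composition is $(\alpha',\beta')\circ(\alpha,\beta)=(\alpha'\circ\alpha,\beta\circ\beta')$. A functor $F\colon\mathcal{C}\to\mathcal{D}$ induces $\widehat F\colon\mathcal{FC}\to\mathcal{FD}$, $\widehat F(\lambda)=F(\lambda)$, $\widehat F(\alpha,\beta)=(F\alpha,F\beta)$. Natural systems. A natural system in $\mathcal{C}$ is a functor $D\colon\mathcal{FC}\to\mathbf{Ab}$; write $D_\lambda=D(\lambda)$ and $D_A=D(\mathrm{id}_A)$. For $\lambda\colon A\to B$, $\alpha\colon B\to B'$, $\beta\colon A'\to A$ write $\alpha_*=D(\alpha,\mathrm{id}_A)\colon D_\lambda\to D_{\alpha\lambda}$ and $\beta^*=D(\mathrm{id}_B,\beta)\colon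 D_\lambda\to D_{\lambda\beta}$. For $F\colon\mathcal{C}\to\mathcal{D}$ and $D$ a natural system in $\mathcal{D}$, $F^*D=D\circ\widehat F$. Cohomology. For $n\ge1$ an $n$-chain is a sequence $(\lambda_1,\dots,\lambda_n)$ of composable morphisms $\lambda_i\colon A_i\to A_{i-1}$; a $0$-chain is an object (identified with its identity). $F^n(\mathcal{C};D)$ is the abelian group of functions $f$ assigning to each $n$-chain an element $f(\lambda_1,\dots,\lambda_n)\in D_{\lambda_1\circ\cdots\circ\lambda_n}$ (for $n=0$: $f(A)\in D_A$). The coboundary is $$\delta f(\lambda_1,\dots,\lambda_n)=\lambda_{1*}f(\lambda_2,\dots,\lambda_n)+\sum_{i=1}^{n-1}(-1)^if(\lambda_1,\dots,\lambda_i\circ\lambda_{i+1},\dots,\lambda_n)+(-1)^n\lambda_n^*f(\lambda_1,\dots,\lambda_{n-1})$$ for $f\in F^{n-1}$, and for $f\in F^0$ and $\lambda\colon A\to B$, $\delta f(\lambda)=\lambda_*f(A)-\lambda^*f(B)$. $\mathrm{H}^n(\mathcal{C};D)$ is the cohomology of $(F^\bullet(\mathcal{C};D),\delta)$. A functor $F\colon\mathcal{C}\to\mathcal{D}$ induces $F^*\colon\mathrm{H}^n(\mathcal{D};D)\to\mathrm{H}^n(\mathcal{C};F^*D)$ by $(F^*f)(\lambda_1,\dots,\lambda_n)=f(F\lambda_1,\dots,F\lambda_n)$. Cup product. An endopairing $\mu\colon(D;D)\to D$ assigns to each $2$-chain $(\lambda_1,\lambda_2)$ a homomorphism $D_{\lambda_1}\otimes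 D_{\lambda_2}\to D_{\lambda_1\circ\lambda_2}$, $x\otimes y\mapsto x\cdot y$, such that, whenever the composites are defined, $(g^*x)\cdot y=x\cdot(g_*y)$, $f_*(x\cdot y)=(f_*x)\cdot y$, $h^*(x\cdot y)=x\cdot(h^*y)$. For $f\in F^n$, $g\in F^m$, $(f\smile g)(\lambda_1,\dots,\lambda_{n+m})=f(\lambda_1,\dots,\lambda_n)\cdot g(\lambda_{n+1},\dots,\lambda_{n+m})$ (for a degree-$0$ cochain, evaluate on the object at the corresponding end of the subchain); this induces a product $\mathrm{H}^n(\mathcal{C};D)\otimes\mathrm{H}^m(\mathcal{C};D)\to\mathrm{H}^{n+m}(\mathcal{C};D)$. Iterated products are bracketed from the left. The cup-length $\mathrm{c.p.l}(S)$ of a subset $S$ of $\mathrm{H}^*(\mathcal{C};D)$ is the largest $n\ge1$ for which there are $n$ (homogeneous) elements $\xi_1,\dots,\xi_n\in S$ of degree $\ge1$ with $\xi_1\smile\cdots\smile\xi_n\ne0$ (it is $0$ if no such $n$ exists, and $\infty$ if such $n$ are unbounded). Bifibrations. For $P\colon\mathcal{E}\to\mathcal{B}$, a morphism $\phi\colon e_1\to e_2$ of $\mathcal{E}$ is Cartesian if for all $\beta\colon e\to e_2$ in $\mathcal{E}$ and $\bar\alpha\colon Pe\to Pe_1$ in $\mathcal{B}$ with $P\phi\circ\bar\alpha=P\beta$ there is a unique $\alpha\colon e\to e_1$ with $\phi\circ\alpha=\beta$ and $P\alpha=\bar\alpha$. $P$ is a fibration if for each $\bar\phi\colon b_1\to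 b_2$ in $\mathcal{B}$ and each object $e_2$ with $Pe_2=b_2$ there is a Cartesian $\phi\colon e_1\to e_2$ with $P\phi=\bar\phi$. $P$ is an op-fibration if $P^{\mathrm{op}}\colon\mathcal{E}^{\mathrm{op}}\to\mathcal{B}^{\mathrm{op}}$ is a fibration, and a bifibration if it is both a fibration and an op-fibration. Homotopy. $\mathbb{I}_m$ ($m\ge0$) is the category with objects $0,\dots,m$ and non-identity arrows the zigzag $0\to1\leftarrow2\to\cdots m$. Functors $F,G\colon\mathcal{C}\to\mathcal{D}$ are homotopic, $F\simeq G$, if for some $m\ge0$ there is a functor $H\colon\mathcal{C}\times\mathbb{I}_m\to\mathcal{D}$ with $H_0=F$ and $H_m=G$, where $H_j$ is the restriction of $H$ to $\mathcal{C}\times\{j\}$. Švarc genus. A family $\{\mathcal{U}_0,\dots,\mathcal{U}_n\}$ of subcategories of $\mathcal{B}$ is a geometric cover of $\mathcal{B}$ if every chain (of any length $\ge0$) in $\mathcal{B}$ belongs to some $\mathcal{U}_i$. The Švarc genus $\mathrm{Sg}(P)$ of a functor $P\colon\mathcal{E}\to\mathcal{B}$ is the least $n\ge0$ such that there is a geometric cover $\{\mathcal{U}_0,\dots,\mathcal{U}_n\}$ of $\mathcal{B}$ and functors $s_i\colon\mathcal{U}_i\to\mathcal{E}$ with $P\circ s_i\simeq\iota_i$, where $\iota_i\colon\mathcal{U}_i\hookrightarrow\mathcal{B}$ is the inclusion; it is $\infty$ if no such $n$ exists. *)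

theory Defs
  imports
    "HOL-Algebra.Algebra"
    "HOL-Library.Extended_Nat"
begin

section \<open>Small categories and functors\<close>

record ('o, 'm) cat =
  Obj :: "'o set"
  Arr :: "'m set"
  Dom :: "'m \<Rightarrow> 'o"
  Cod :: "'m \<Rightarrow> 'o"
  Ident :: "'o \<Rightarrow> 'm"
  Comp :: "'m \<Rightarrow> 'm \<Rightarrow> 'm"  (infixl \<open>\<bullet>\<index>\<close> 70)

text \<open>Composition is in the usual order: \<open>g \<bullet> f\<close> is ``first \<open>f\<close>, then \<open>g\<close>''.
  All data are only meaningful on the carriers \<^const>\<open>Obj\<close> and \<^const>\<open>Arr\<close>, and
  composites only when \<open>Dom g = Cod f\<close>.\<close>

definition Hom :: "('o, 'm) cat \<Rightarrow> 'o \<Rightarrow> 'o \<Rightarrow> 'm set" where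
  "Hom C A B = {f \<in> Arr C. Dom C f = A \<and> Cod C f = B}"

locale category =
  fixes C :: "('o, 'm) cat" (structure)
  assumes Dom_Obj: "f \<in> Arr C \<Longrightarrow> Dom C f \<in> Obj C"
    and Cod_Obj: "f \<in> Arr C \<Longrightarrow> Cod C f \<in> Obj C"
    and Ident_Hom: "A \<in> Obj C \<Longrightarrow> Ident C A \<in> Hom C A A"
    and Comp_Hom: "\<lbrakk>f \<in> Arr C; g \<in> Arr C; Dom C g = Cod C f\<rbrakk>
      \<Longrightarrow> g \<bullet> f \<in> Hom C (Dom C f) (Cod C g)"
    and Ident_left: "f \<in> Arr C \<Longrightarrow> Ident C (Cod C f) \<bullet> f = f"
    and Ident_right: "f \<in> Arr C \<Longrightarrow> f \<bullet> Ident C (Dom C f) = f"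
    and Comp_assoc: "\<lbrakk>f \<in> Arr C; g \<in> Arr C; h \<in> Arr C; Dom C g = Cod C f; Dom C h = Cod C g\<rbrakk>
      \<Longrightarrow> (h \<bullet> g) \<bullet> f = h \<bullet> (g \<bullet> f)"

record ('o1, 'm1, 'o2, 'm2) ftor =
  FObj :: "'o1 \<Rightarrow> 'o2"
  FArr :: "'m1 \<Rightarrow> 'm2"

definition is_functor ::
  "('o1, 'm1) cat \<Rightarrow> ('o2, 'm2) cat \<Rightarrow> ('o1, 'm1, 'o2, 'm2) ftor \<Rightarrow> bool" where
  "is_functor C D F \<longleftrightarrow>
     (\<forall>A\<in>Obj C. FObj F A \<in> Obj D) \<and>
     (\<forall>f\<in>Arr C. FArr F f \<in> Hom D (FObj F (Dom C f)) (FObj F (Cod C f))) \<and>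
     (\<forall>A\<in>Obj C. FArr F (Ident C A) = Ident D (FObj F A)) \<and>
     (\<forall>f\<in>Arr C. \<forall>g\<in>Arr C. Dom C g = Cod C f \<longrightarrow>
        FArr F (g \<bullet>\<^bsub>C\<^esub> f) = FArr F g \<bullet>\<^bsub>D\<^esub> FArr F f)"

text \<open>Equality of functors with source \<open>C\<close>: their values off the carriers of \<open>C\<close> are irrelevant.\<close>

definition functor_eq ::
  "('o1, 'm1) cat \<Rightarrow> ('o1, 'm1, 'o2, 'm2) ftor \<Rightarrow> ('o1, 'm1, 'o2, 'm2) ftor \<Rightarrow> bool" where
  "functor_eq C F G \<longleftrightarrow>
     (\<forall>A\<in>Obj C. FObj F A = FObj G A) \<and> (\<forall>f\<in>Arr C. FArr F f = FArr G f)"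

definition functor_comp ::
  "('o2, 'm2, 'o3, 'm3) ftor \<Rightarrow> ('o1, 'm1, 'o2, 'm2) ftor \<Rightarrow> ('o1, 'm1, 'o3, 'm3) ftor" where
  "functor_comp G F = \<lparr>FObj = FObj G \<circ> FObj F, FArr = FArr G \<circ> FArr F\<rparr>"

definition subcategory :: "('o, 'm) cat \<Rightarrow> ('o, 'm) cat \<Rightarrow> bool" where
  "subcategory U C \<longleftrightarrow> category U \<and> Obj U \<subseteq> Obj C \<and> Arr U \<subseteq> Arr C \<and>
     (\<forall>f\<in>Arr U. Dom U f = Dom C f \<and> Cod U f = Cod C f) \<and>
     (\<forall>A\<in>Obj U. Ident U A = Ident C A) \<and>
     (\<forall>f\<in>Arr U. \<forall>g\<in>Arr U. Dom C g = Cod C f \<longrightarrow> g \<bullet>\<^bsub>U\<^esub> f = g \<bullet>\<^bsub>C\<^esub> f)"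

definition inclusion :: "('o, 'm, 'o, 'm) ftor" where
  "inclusion = \<lparr>FObj = (\<lambda>A. A), FArr = (\<lambda>f. f)\<rparr>"

definition op_cat :: "('o, 'm) cat \<Rightarrow> ('o, 'm) cat" where
  "op_cat C = \<lparr>Obj = Obj C, Arr = Arr C, Dom = Cod C, Cod = Dom C, Ident = Ident C,
     Comp = (\<lambda>g f. f \<bullet>\<^bsub>C\<^esub> g)\<rparr>"

definition prod_cat :: "('o1, 'm1) cat \<Rightarrow> ('o2, 'm2) cat \<Rightarrow> ('o1 \<times> 'o2, 'm1 \<times> 'm2) cat" where
  "prod_cat C D = \<lparr>Obj = Obj C \<times> Obj D, Arr = Arr C \<times> Arr D,
     Dom = (\<lambda>(f, g). (Dom C f, Dom D g)), Cod = (\<lambda>(f, g). (Cod C f, Cod D g)),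
     Ident = (\<lambda>(A, B). (Ident C A, Ident D B)),
     Comp = (\<lambda>(f', g') (f, g). (f' \<bullet>\<^bsub>C\<^esub> f, g' \<bullet>\<^bsub>D\<^esub> g))\<rparr>"


section \<open>Bifibrations\<close>

definition cartesian ::
  "('p, 'q) cat \<Rightarrow> ('o, 'm) cat \<Rightarrow> ('p, 'q, 'o, 'm) ftor \<Rightarrow> 'q \<Rightarrow> bool" where
  "cartesian E B P \<phi> \<longleftrightarrow> \<phi> \<in> Arr E \<and>
     (\<forall>e\<in>Obj E. \<forall>\<beta>\<in>Hom E e (Cod E \<phi>). \<forall>\<alpha>'\<in>Hom B (FObj P e) (FObj P (Dom E \<phi>)).
        FArr P \<phi> \<bullet>\<^bsub>B\<^esub> \<alpha>' = FArr P \<beta> \<longrightarrow>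
        (\<exists>!\<alpha>. \<alpha> \<in> Hom E e (Dom E \<phi>) \<and> \<phi> \<bullet>\<^bsub>E\<^esub> \<alpha> = \<beta> \<and> FArr P \<alpha> = \<alpha>'))"

definition fibration ::
  "('p, 'q) cat \<Rightarrow> ('o, 'm) cat \<Rightarrow> ('p, 'q, 'o, 'm) ftor \<Rightarrow> bool" where
  "fibration E B P \<longleftrightarrow> is_functor E B P \<and>
     (\<forall>b1\<in>Obj B. \<forall>b2\<in>Obj B. \<forall>\<phi>'\<in>Hom B b1 b2. \<forall>e2\<in>Obj E. FObj P e2 = b2 \<longrightarrow>
        (\<exists>e1\<in>Obj E. \<exists>\<phi>\<in>Hom E e1 e2. cartesian E B P \<phi> \<and> FArr P \<phi> = \<phi>'))"

text \<open>The functor \<open>P\<^sup>o\<^sup>p\<close> has the same object and arrow maps as \<open>P\<close>.\<close>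

definition op_fibration ::
  "('p, 'q) cat \<Rightarrow> ('o, 'm) cat \<Rightarrow> ('p, 'q, 'o, 'm) ftor \<Rightarrow> bool" where
  "op_fibration E B P \<longleftrightarrow> fibration (op_cat E) (op_cat B) P"

definition bifibration ::
  "('p, 'q) cat \<Rightarrow> ('o, 'm) cat \<Rightarrow> ('p, 'q, 'o, 'm) ftor \<Rightarrow> bool" where
  "bifibration E B P \<longleftrightarrow> fibration E B P \<and> op_fibration E B P"


section \<open>Homotopy of functors\<close>

text \<open>The zigzag \<open>0 \<rightarrow> 1 \<leftarrow> 2 \<rightarrow> \<dots> m\<close> has at most one arrow from \<open>i\<close> to \<open>j\<close>, represented by the
  pair \<open>(i, j)\<close>; non-identity arrows run from an even object to an adjacent odd one.\<close>

definition zigzag :: "nat \<Rightarrow> (nat, nat \<times> nat) cat" where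
  "zigzag m = \<lparr>Obj = {..m},
     Arr = {(i, j). i \<le> m \<and> j \<le> m \<and> (i = j \<or> even i \<and> (j = i + 1 \<or> i = j + 1))},
     Dom = fst, Cod = snd, Ident = (\<lambda>i. (i, i)), Comp = (\<lambda>g f. (fst f, snd g))\<rparr>"

definition level :: "('o \<times> nat, 'm \<times> (nat \<times> nat), 'p, 'q) ftor \<Rightarrow> nat \<Rightarrow> ('o, 'm, 'p, 'q) ftor" where
  "level H j = \<lparr>FObj = (\<lambda>A. FObj H (A, j)), FArr = (\<lambda>f. FArr H (f, (j, j)))\<rparr>"

definition homotopic :: "('o1, 'm1) cat \<Rightarrow> ('o2, 'm2) cat \<Rightarrow>
    ('o1, 'm1, 'o2, 'm2) ftor \<Rightarrow> ('o1, 'm1, 'o2, 'm2) ftor \<Rightarrow> bool" where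
  "homotopic C D F G \<longleftrightarrow> (\<exists>m H. is_functor (prod_cat C (zigzag m)) D H \<and>
     functor_eq C (level H 0) F \<and> functor_eq C (level H m) G)"


section \<open>Factorization category and natural systems\<close>

text \<open>An arrow \<open>(\<alpha>, \<beta>)\<close> of the factorization category with source \<open>\<lambda>\<close> is the triple
  \<open>(\<lambda>, \<alpha>, \<beta>)\<close>; its target \<open>\<alpha> \<circ> \<lambda> \<circ> \<beta>\<close> is determined by these data.\<close>

definition fact_cat :: "('o, 'm) cat \<Rightarrow> ('m, 'm \<times> 'm \<times> 'm) cat" where
  "fact_cat C = \<lparr>Obj = Arr C,
     Arr = {(l, \<alpha>, \<beta>). l \<in> Arr C \<and> \<alpha> \<in> Arr C \<and> \<beta> \<in> Arr C \<and> Dom C \<alpha> = Cod C l \<and> Cod C \<beta> = Dom C l},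
     Dom = (\<lambda>(l, \<alpha>, \<beta>). l),
     Cod = (\<lambda>(l, \<alpha>, \<beta>). \<alpha> \<bullet>\<^bsub>C\<^esub> l \<bullet>\<^bsub>C\<^esub> \<beta>),
     Ident = (\<lambda>l. (l, Ident C (Cod C l), Ident C (Dom C l))),
     Comp = (\<lambda>(l', \<alpha>', \<beta>') (l, \<alpha>, \<beta>). (l, \<alpha>' \<bullet>\<^bsub>C\<^esub> \<alpha>, \<beta> \<bullet>\<^bsub>C\<^esub> \<beta>'))\<rparr>"

definition fact_functor ::
  "('o1, 'm1, 'o2, 'm2) ftor \<Rightarrow> ('m1, 'm1 \<times> 'm1 \<times> 'm1, 'm2, 'm2 \<times> 'm2 \<times> 'm2) ftor" where
  "fact_functor F = \<lparr>FObj = FArr F, FArr = (\<lambda>(l, \<alpha>, \<beta>). (FArr F l, FArr F \<alpha>, FArr F \<beta>))\<rparr>"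

text \<open>Functors to abelian groups. The groups are \<^locale>\<open>comm_group\<close>s and hence
  written multiplicatively: \<open>\<otimes>\<close> is the sum, \<open>\<one>\<close> the zero element, and
  \<open>x [^] k\<close> the integer multiple \<open>k x\<close>.\<close>

record ('o, 'm, 'a) ab_ftor =
  Gr :: "'o \<Rightarrow> 'a monoid"
  Mp :: "'m \<Rightarrow> 'a \<Rightarrow> 'a"

definition is_ab_functor :: "('o, 'm) cat \<Rightarrow> ('o, 'm, 'a) ab_ftor \<Rightarrow> bool" where
  "is_ab_functor C D \<longleftrightarrow>
     (\<forall>A\<in>Obj C. comm_group (Gr D A)) \<and>
     (\<forall>f\<in>Arr C. Mp D f \<in> hom (Gr D (Dom C f)) (Gr D (Cod C f))) \<and>
     (\<forall>A\<in>Obj C. \<forall>x\<in>carrier (Gr D A). Mp D (Ident C A) x = x) \<and>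
     (\<forall>f\<in>Arr C. \<forall>g\<in>Arr C. Dom C g = Cod C f \<longrightarrow>
        (\<forall>x\<in>carrier (Gr D (Dom C f)). Mp D (g \<bullet>\<^bsub>C\<^esub> f) x = Mp D g (Mp D f x)))"

type_synonym ('m, 'a) nat_sys = "('m, 'm \<times> 'm \<times> 'm, 'a) ab_ftor"

definition natural_system :: "('o, 'm) cat \<Rightarrow> ('m, 'a) nat_sys \<Rightarrow> bool" where
  "natural_system C D \<longleftrightarrow> is_ab_functor (fact_cat C) D"

text \<open>\<open>push C D \<alpha> l\<close> is \<open>\<alpha>\<^sub>*\<close> and \<open>pull C D \<beta> l\<close> is \<open>\<beta>\<^sup>*\<close>, both with source \<open>D\<^sub>l\<close>.\<close>

definition push :: "('o, 'm) cat \<Rightarrow> ('m, 'a) nat_sys \<Rightarrow> 'm \<Rightarrow> 'm \<Rightarrow> 'a \<Rightarrow> 'a" where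
  "push C D \<alpha> l = Mp D (l, \<alpha>, Ident C (Dom C l))"

definition pull :: "('o, 'm) cat \<Rightarrow> ('m, 'a) nat_sys \<Rightarrow> 'm \<Rightarrow> 'm \<Rightarrow> 'a \<Rightarrow> 'a" where
  "pull C D \<beta> l = Mp D (l, Ident C (Cod C l), \<beta>)"

definition restrict_ns :: "('o1, 'm1, 'o2, 'm2) ftor \<Rightarrow> ('m2, 'a) nat_sys \<Rightarrow> ('m1, 'a) nat_sys" where
  "restrict_ns F D =
     \<lparr>Gr = Gr D \<circ> FObj (fact_functor F), Mp = Mp D \<circ> FArr (fact_functor F)\<rparr>"


section \<open>Chains and Baues--Wirsching cohomology\<close>

text \<open>An \<open>n\<close>-chain \<open>A\<^sub>0 \<leftarrow> A\<^sub>1 \<leftarrow> \<dots> \<leftarrow> A\<^sub>n\<close> is the pair of its end object \<open>A\<^sub>0\<close> and the list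
  \<open>[\<lambda>\<^sub>1, \<dots>, \<lambda>\<^sub>n]\<close> with \<open>\<lambda>\<^sub>i : A\<^sub>i \<rightarrow> A\<^sub>i\<^sub>-\<^sub>1\<close>. For \<open>n \<ge> 1\<close> the object is redundant (it is the codomain of
  \<open>\<lambda>\<^sub>1\<close>); for \<open>n = 0\<close> the chain is the object \<open>A\<^sub>0\<close>.\<close>

type_synonym ('o, 'm) chain = "'o \<times> 'm list"

primrec composable :: "('o, 'm) cat \<Rightarrow> 'o \<Rightarrow> 'm list \<Rightarrow> bool" where
  "composable C A [] \<longleftrightarrow> A \<in> Obj C"
| "composable C A (f # fs) \<longleftrightarrow> f \<in> Arr C \<and> Cod C f = A \<and> composable C (Dom C f) fs"

definition chains_of :: "('o, 'm) cat \<Rightarrow> nat \<Rightarrow> ('o, 'm) chain set" where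
  "chains_of C n = {(A, fs). length fs = n \<and> composable C A fs}"

primrec list_composite :: "('o, 'm) cat \<Rightarrow> 'o \<Rightarrow> 'm list \<Rightarrow> 'm" where
  "list_composite C A [] = Ident C A"
| "list_composite C A (f # fs) = f \<bullet>\<^bsub>C\<^esub> list_composite C (Dom C f) fs"

definition composite :: "('o, 'm) cat \<Rightarrow> ('o, 'm) chain \<Rightarrow> 'm" where
  "composite C \<sigma> = list_composite C (fst \<sigma>) (snd \<sigma>)"

text \<open>The initial piece \<open>(\<lambda>\<^sub>1, \<dots>, \<lambda>\<^sub>n)\<close> of a chain, the piece \<open>(\<lambda>\<^sub>n\<^sub>+\<^sub>1, \<dots>)\<close> that is left, and
  the chain in which \<open>\<lambda>\<^sub>i\<close> and \<open>\<lambda>\<^sub>i\<^sub>+\<^sub>1\<close> (the list entries \<open>i - 1\<close> and \<open>i\<close>) are composed.\<close>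

definition chain_front :: "nat \<Rightarrow> ('o, 'm) chain \<Rightarrow> ('o, 'm) chain" where
  "chain_front n \<sigma> = (fst \<sigma>, take n (snd \<sigma>))"

definition chain_back :: "('o, 'm) cat \<Rightarrow> nat \<Rightarrow> ('o, 'm) chain \<Rightarrow> ('o, 'm) chain" where
  "chain_back C n \<sigma> = (if n = 0 then fst \<sigma> else Dom C (snd \<sigma> ! (n - 1)), drop n (snd \<sigma>))"

definition chain_merge :: "('o, 'm) cat \<Rightarrow> nat \<Rightarrow> ('o, 'm) chain \<Rightarrow> ('o, 'm) chain" where
  "chain_merge C i \<sigma> = (fst \<sigma>,
     take (i - 1) (snd \<sigma>) @ [snd \<sigma> ! (i - 1) \<bullet>\<^bsub>C\<^esub> snd \<sigma> ! i] @ drop (i + 1) (snd \<sigma>))"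

text \<open>Cochains are extensional functions, i.e. \<^term>\<open>undefined\<close> off the \<open>n\<close>-chains.\<close>

type_synonym ('o, 'm, 'a) cochain = "('o, 'm) chain \<Rightarrow> 'a"

definition cochain_group ::
  "('o, 'm) cat \<Rightarrow> ('m, 'a) nat_sys \<Rightarrow> nat \<Rightarrow> ('o, 'm, 'a) cochain monoid" where
  "cochain_group C D n = product_group (chains_of C n) (\<lambda>\<sigma>. Gr D (composite C \<sigma>))"

text \<open>\<open>delta C D n\<close> is \<open>\<delta> : F\<^sup>n \<rightarrow> F\<^sup>n\<^sup>+\<^sup>1\<close>. For \<open>n = 0\<close> the product over \<open>i\<close> is empty, and
  for \<open>\<lambda> : A \<rightarrow> B\<close> the formula reads \<open>\<lambda>\<^sub>* f(A) - \<lambda>\<^sup>* f(B)\<close>.\<close>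

definition delta :: "('o, 'm) cat \<Rightarrow> ('m, 'a) nat_sys \<Rightarrow> nat \<Rightarrow>
    ('o, 'm, 'a) cochain \<Rightarrow> ('o, 'm, 'a) cochain" where
  "delta C D n f = (\<lambda>\<sigma>\<in>chains_of C (Suc n).
     let G = Gr D (composite C \<sigma>) in
       push C D (hd (snd \<sigma>)) (composite C (chain_back C 1 \<sigma>)) (f (chain_back C 1 \<sigma>))
       \<otimes>\<^bsub>G\<^esub> (\<Otimes>\<^bsub>G\<^esub>i\<in>{1..n}. f (chain_merge C i \<sigma>) [^]\<^bsub>G\<^esub> ((- 1) ^ i :: int))
       \<otimes>\<^bsub>G\<^esub> pull C D (last (snd \<sigma>)) (composite C (chain_front n \<sigma>)) (f (chain_front n \<sigma>))
            [^]\<^bsub>G\<^esub> ((- 1) ^ Suc n :: int))"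

definition cocycles ::
  "('o, 'm) cat \<Rightarrow> ('m, 'a) nat_sys \<Rightarrow> nat \<Rightarrow> ('o, 'm, 'a) cochain set" where
  "cocycles C D n = kernel (cochain_group C D n) (cochain_group C D (Suc n)) (delta C D n)"

definition coboundaries ::
  "('o, 'm) cat \<Rightarrow> ('m, 'a) nat_sys \<Rightarrow> nat \<Rightarrow> ('o, 'm, 'a) cochain set" where
  "coboundaries C D n = (case n of
       0 \<Rightarrow> {\<one>\<^bsub>cochain_group C D 0\<^esub>}
     | Suc k \<Rightarrow> delta C D k ` carrier (cochain_group C D k))"

definition cohomology ::
  "('o, 'm) cat \<Rightarrow> ('m, 'a) nat_sys \<Rightarrow> nat \<Rightarrow> ('o, 'm, 'a) cochain set monoid" where
  "cohomology C D n =
     (cochain_group C D n)\<lparr>carrier := cocycles C D n\<rparr> Mod coboundaries C D n"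

definition cohomology_class :: "('o, 'm) cat \<Rightarrow> ('m, 'a) nat_sys \<Rightarrow> nat \<Rightarrow>
    ('o, 'm, 'a) cochain \<Rightarrow> ('o, 'm, 'a) cochain set" where
  "cohomology_class C D n f = coboundaries C D n #>\<^bsub>cochain_group C D n\<^esub> f"

definition map_chain :: "('o1, 'm1, 'o2, 'm2) ftor \<Rightarrow> ('o1, 'm1) chain \<Rightarrow> ('o2, 'm2) chain" where
  "map_chain F \<sigma> = (FObj F (fst \<sigma>), map (FArr F) (snd \<sigma>))"

definition induced_cochain :: "('o1, 'm1) cat \<Rightarrow> ('o1, 'm1, 'o2, 'm2) ftor \<Rightarrow> nat \<Rightarrow>
    ('o2, 'm2, 'a) cochain \<Rightarrow> ('o1, 'm1, 'a) cochain" where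
  "induced_cochain C F n f = (\<lambda>\<sigma>\<in>chains_of C n. f (map_chain F \<sigma>))"

text \<open>A map induced on classes is the union of its values over all representatives; these
  values are all equal because the map is well defined.\<close>

definition induced :: "('o1, 'm1) cat \<Rightarrow> ('o1, 'm1, 'o2, 'm2) ftor \<Rightarrow> ('m2, 'a) nat_sys \<Rightarrow> nat \<Rightarrow>
    ('o2, 'm2, 'a) cochain set \<Rightarrow> ('o1, 'm1, 'a) cochain set" where
  "induced C F D n \<xi> =
     (\<Union>f\<in>\<xi>. cohomology_class C (restrict_ns F D) n (induced_cochain C F n f))"


section \<open>Cup product and cup-length\<close>

text \<open>A homomorphism from \<open>D\<^sub>l\<^sub>1 \<otimes> D\<^sub>l\<^sub>2\<close> is given as the corresponding biadditive map.\<close>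

definition biadditive :: "'a monoid \<Rightarrow> 'a monoid \<Rightarrow> 'a monoid \<Rightarrow> ('a \<Rightarrow> 'a \<Rightarrow> 'a) \<Rightarrow> bool" where
  "biadditive G H K b \<longleftrightarrow>
     (\<forall>x\<in>carrier G. b x \<in> hom H K) \<and> (\<forall>y\<in>carrier H. (\<lambda>x. b x y) \<in> hom G K)"

definition endopairing ::
  "('o, 'm) cat \<Rightarrow> ('m, 'a) nat_sys \<Rightarrow> ('m \<Rightarrow> 'm \<Rightarrow> 'a \<Rightarrow> 'a \<Rightarrow> 'a) \<Rightarrow> bool" where
  "endopairing C D \<mu> \<longleftrightarrow>
     (\<forall>l1\<in>Arr C. \<forall>l2\<in>Arr C. Dom C l1 = Cod C l2 \<longrightarrow>
        biadditive (Gr D l1) (Gr D l2) (Gr D (l1 \<bullet>\<^bsub>C\<^esub> l2)) (\<mu> l1 l2)) \<and>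
     (\<forall>l1\<in>Arr C. \<forall>g\<in>Arr C. \<forall>l2\<in>Arr C. Dom C l1 = Cod C g \<longrightarrow> Dom C g = Cod C l2 \<longrightarrow>
        (\<forall>x\<in>carrier (Gr D l1). \<forall>y\<in>carrier (Gr D l2).
           \<mu> (l1 \<bullet>\<^bsub>C\<^esub> g) l2 (pull C D g l1 x) y = \<mu> l1 (g \<bullet>\<^bsub>C\<^esub> l2) x (push C D g l2 y))) \<and>
     (\<forall>f\<in>Arr C. \<forall>l1\<in>Arr C. \<forall>l2\<in>Arr C. Dom C f = Cod C l1 \<longrightarrow> Dom C l1 = Cod C l2 \<longrightarrow>
        (\<forall>x\<in>carrier (Gr D l1). \<forall>y\<in>carrier (Gr D l2).
           push C D f (l1 \<bullet>\<^bsub>C\<^esub> l2) (\<mu> l1 l2 x y) = \<mu> (f \<bullet>\<^bsub>C\<^esub> l1) l2 (push C D f l1 x) y)) \<and>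
     (\<forall>l1\<in>Arr C. \<forall>l2\<in>Arr C. \<forall>h\<in>Arr C. Dom C l1 = Cod C l2 \<longrightarrow> Dom C l2 = Cod C h \<longrightarrow>
        (\<forall>x\<in>carrier (Gr D l1). \<forall>y\<in>carrier (Gr D l2).
           pull C D h (l1 \<bullet>\<^bsub>C\<^esub> l2) (\<mu> l1 l2 x y) = \<mu> l1 (l2 \<bullet>\<^bsub>C\<^esub> h) x (pull C D h l2 y)))"

definition cup_cochain :: "('o, 'm) cat \<Rightarrow> ('m \<Rightarrow> 'm \<Rightarrow> 'a \<Rightarrow> 'a \<Rightarrow> 'a) \<Rightarrow> nat \<Rightarrow> nat \<Rightarrow>
    ('o, 'm, 'a) cochain \<Rightarrow> ('o, 'm, 'a) cochain \<Rightarrow> ('o, 'm, 'a) cochain" where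
  "cup_cochain C \<mu> n m f g = (\<lambda>\<sigma>\<in>chains_of C (n + m).
     \<mu> (composite C (chain_front n \<sigma>)) (composite C (chain_back C n \<sigma>)) (f (chain_front n \<sigma>)) (g (chain_back C n \<sigma>)))"

text \<open>A homogeneous element of \<open>H\<^sup>*(C; D)\<close> is a pair of a degree and a class in that degree.\<close>

type_synonym ('o, 'm, 'a) hclass = "nat \<times> ('o, 'm, 'a) cochain set"

definition cup :: "('o, 'm) cat \<Rightarrow> ('m, 'a) nat_sys \<Rightarrow> ('m \<Rightarrow> 'm \<Rightarrow> 'a \<Rightarrow> 'a \<Rightarrow> 'a) \<Rightarrow>
    ('o, 'm, 'a) hclass \<Rightarrow> ('o, 'm, 'a) hclass \<Rightarrow> ('o, 'm, 'a) hclass" where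
  "cup C D \<mu> = (\<lambda>(n, \<xi>) (m, \<eta>).
     (n + m, \<Union>f\<in>\<xi>. \<Union>g\<in>\<eta>. cohomology_class C D (n + m) (cup_cochain C \<mu> n m f g)))"

definition cup_list :: "('o, 'm) cat \<Rightarrow> ('m, 'a) nat_sys \<Rightarrow> ('m \<Rightarrow> 'm \<Rightarrow> 'a \<Rightarrow> 'a \<Rightarrow> 'a) \<Rightarrow>
    ('o, 'm, 'a) hclass list \<Rightarrow> ('o, 'm, 'a) hclass" where
  "cup_list C D \<mu> xs = foldl (cup C D \<mu>) (hd xs) (tl xs)"

text \<open>Only the homogeneous elements of a subset of \<open>H\<^sup>*\<close> matter for its cup-length, so \<open>S\<close> is a
  set of homogeneous elements. In \<^typ>\<open>enat\<close>, \<open>Sup\<close> of the empty set is \<open>0\<close> and \<open>Sup\<close> of an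
  unbounded set is \<open>\<infinity>\<close>; \<open>Inf\<close> of the empty set is \<open>\<infinity>\<close>.\<close>

definition cup_length :: "('o, 'm) cat \<Rightarrow> ('m, 'a) nat_sys \<Rightarrow> ('m \<Rightarrow> 'm \<Rightarrow> 'a \<Rightarrow> 'a \<Rightarrow> 'a) \<Rightarrow>
    ('o, 'm, 'a) hclass set \<Rightarrow> enat" where
  "cup_length C D \<mu> S = Sup (enat ` {n. n \<ge> 1 \<and>
     (\<exists>xs. length xs = n \<and> set xs \<subseteq> S \<and> (\<forall>x\<in>set xs. fst x \<ge> 1) \<and>
        (let (d, \<zeta>) = cup_list C D \<mu> xs in \<zeta> \<noteq> \<one>\<^bsub>cohomology C D d\<^esub>))})"

definition ker_induced :: "('o1, 'm1) cat \<Rightarrow> ('o2, 'm2) cat \<Rightarrow> ('o1, 'm1, 'o2, 'm2) ftor \<Rightarrow>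
    ('m2, 'a) nat_sys \<Rightarrow> ('o2, 'm2, 'a) hclass set" where
  "ker_induced C C' F D =
     (SIGMA n:UNIV. kernel (cohomology C' D n) (cohomology C (restrict_ns F D) n) (induced C F D n))"


section \<open>The Svarc genus\<close>

definition geometric_cover :: "('o, 'm) cat \<Rightarrow> nat \<Rightarrow> (nat \<Rightarrow> ('o, 'm) cat) \<Rightarrow> bool" where
  "geometric_cover B n U \<longleftrightarrow> (\<forall>i\<le>n. subcategory (U i) B) \<and>
     (\<forall>k. \<forall>\<sigma>\<in>chains_of B k. \<exists>i\<le>n. \<sigma> \<in> chains_of (U i) k)"

definition svarc_genus :: "('p, 'q) cat \<Rightarrow> ('o, 'm) cat \<Rightarrow> ('p, 'q, 'o, 'm) ftor \<Rightarrow> enat" where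
  "svarc_genus E B P = Inf (enat ` {n. \<exists>U s. geometric_cover B n U \<and>
     (\<forall>i\<le>n. is_functor (U i) E (s i) \<and> homotopic (U i) B (functor_comp P (s i)) inclusion)})"

end

theory Submission
  imports Defs
begin

text \<open>
  Lifting a homotopy from \<open>P s\<^sub>i\<close> to the inclusion of \<open>U\<^sub>i\<close> one arrow of the zigzag at a time, along
  Cartesian or op-Cartesian arrows, turns \<open>s\<^sub>i\<close> into a strict section of \<open>P\<close> over \<open>U\<^sub>i\<close>. If \<open>f\<close> is a
  cocycle of positive degree with \<open>P\<^sup>* f = \<delta> g\<close>, then on the chains of \<open>U\<^sub>i\<close> it equals the coboundary
  of \<open>s\<^sub>i\<^sup>* g\<close>; subtracting the coboundary of the extension by zero of \<open>s\<^sub>i\<^sup>* g\<close> gives a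
  cohomologous cocycle that vanishes on the chains of \<open>U\<^sub>i\<close>. The cup product of \<open>n + 1\<close> classes of the
  kernel, represented by cocycles vanishing on \<open>U\<^sub>0, \<dots>, U\<^sub>n\<close> respectively, vanishes on every chain,
  because every chain lies in some \<open>U\<^sub>i\<close> together with its front and back pieces.
\<close>

section \<open>Chains as functors on ordinals\<close>


text \<open>Strictness is what the lifting buys: with \<open>P s_i\<close> equal to the identity on
  the nose, \<open>P^* D\<close> pulled back along \<open>s_i\<close> is \<open>D\<close> restricted
  to \<open>U_i\<close>, so cochains are transferred literally and coefficients never have to be
  compared along a homotopy. The arrows of a zigzag point both ways, hence both kinds of lift.
  Vanishing is arranged on cochains. It propagates because a subcategory is closed under
  composition: every face, front piece and back piece of a chain of \<open>U_i\<close> is again a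
  chain of \<open>U_i\<close>. Products and induced maps of classes are unions over all
  representatives. Passing to vanishing representatives therefore rests on a Leibniz rule in which
  the coefficient group varies with the chain; the long middle of the proof establishes it. Positive
  degree enters because a coboundary of degree \<open>d\<close> has its primitive \<open>g\<close>
  in degree \<open>d - 1\<close>. A product with more than \<open>n + 1\<close> factors is killed by
  its first \<open>n + 1\<close> factors; the others keep arbitrary representatives.\<close>

context category
begin

lemma Comp_arr [simp]:
  assumes "f \<in> Arr C" "g \<in> Arr C" "Dom C g = Cod C f"
  shows "g \<bullet> f \<in> Arr C" "Dom C (g \<bullet> f) = Dom C f" "Cod C (g \<bullet> f) = Cod C g"
  using Comp_Hom[OF assms] by (auto simp: Hom_def)

lemma Ident_arr [simp]:
  assumes "A \<in> Obj C"
  shows "Ident C A \<in> Arr C" "Dom C (Ident C A) = A" "Cod C (Ident C A) = A"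
  using Ident_Hom[OF assms] by (auto simp: Hom_def)

lemma Ident_left': "f \<in> Arr C \<Longrightarrow> Cod C f = A \<Longrightarrow> Ident C A \<bullet> f = f"
  using Ident_left by blast

lemma Ident_right': "f \<in> Arr C \<Longrightarrow> Dom C f = A \<Longrightarrow> f \<bullet> Ident C A = f"
  using Ident_right by blast

end

text \<open>
  An \<open>n\<close>-chain is regarded as a functor on the ordinal \<open>{0, \<dots>, n}\<close>, with vertices \<open>A\<^sub>i\<close> and arrows
  \<open>segment i j : A\<^sub>j \<rightarrow> A\<^sub>i\<close>. Faces, front and back pieces are then all precompositions with monotone
  maps, and the simplicial identities become identities between maps of numbers.
\<close>

definition vertex :: "('o, 'm) cat \<Rightarrow> ('o, 'm) chain \<Rightarrow> nat \<Rightarrow> 'o" where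
  "vertex C \<sigma> i = (if i = 0 then fst \<sigma> else Dom C (snd \<sigma> ! (i - 1)))"

definition segment :: "('o, 'm) cat \<Rightarrow> ('o, 'm) chain \<Rightarrow> nat \<Rightarrow> nat \<Rightarrow> 'm" where
  "segment C \<sigma> i j = list_composite C (vertex C \<sigma> i) (take (j - i) (drop i (snd \<sigma>)))"

definition reindex :: "('o, 'm) cat \<Rightarrow> nat \<Rightarrow> (nat \<Rightarrow> nat) \<Rightarrow> ('o, 'm) chain \<Rightarrow> ('o, 'm) chain" where
  "reindex C m \<theta> \<sigma> =
     (vertex C \<sigma> (\<theta> 0), map (\<lambda>k. segment C \<sigma> (\<theta> k) (\<theta> (Suc k))) [0..<m])"

definition coface :: "nat \<Rightarrow> nat \<Rightarrow> nat" where
  "coface i k = (if k < i then k else Suc k)"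

text \<open>Replaces the recursion of \<open>composable\<close> by conditions on single entries, so
  that chains given by \<open>map\<close> can be checked index by index. Dropping the head of the
  list shifts \<open>vertex\<close> by one, which drives the induction.\<close>

lemma composable_iff:
  "composable C A fs \<longleftrightarrow>
     A \<in> Obj C \<and> (\<forall>i<length fs. fs ! i \<in> Arr C \<and> Cod C (fs ! i) = vertex C (A, fs) i)"
  if "category C"
proof -
  interpret category C by fact
  show ?thesis
  proof (induction fs arbitrary: A)
    case (Cons f fs)
    have *: "vertex C (A, f # fs) (Suc i) = vertex C (Dom C f, fs) i" for i
      by (cases i) (auto simp: vertex_def)
    show ?case
      using Dom_Obj Cod_Obj by (auto simp: Cons.IH All_less_Suc2 *) (auto simp: vertex_def)
  qed simp
qed

lemma chains_of_iff:
  "\<sigma> \<in> chains_of C n \<longleftrightarrow> length (snd \<sigma>) = n \<and> fst \<sigma> \<in> Obj C \<and>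
     (\<forall>i<n. snd \<sigma> ! i \<in> Arr C \<and> Cod C (snd \<sigma> ! i) = vertex C \<sigma> i)"
  if "category C"
  by (cases \<sigma>) (auto simp: chains_of_def composable_iff[OF that])

lemma length_reindex [simp]: "length (snd (reindex C m \<theta> \<sigma>)) = m"
  by (simp add: reindex_def)

lemma reindex_nth: "k < m \<Longrightarrow> snd (reindex C m \<theta> \<sigma>) ! k = segment C \<sigma> (\<theta> k) (\<theta> (Suc k))"
  by (simp add: reindex_def)

lemma reindex_cong:
  "(\<And>k. k \<le> m \<Longrightarrow> \<theta> k = \<psi> k) \<Longrightarrow> reindex C m \<theta> \<sigma> = reindex C m \<psi> \<sigma>"
  by (auto simp: reindex_def)

lemma mono_coface [simp]: "mono (coface i)"
  by (auto simp: mono_def coface_def)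

lemma coface_le: "k \<le> n \<Longrightarrow> coface i k \<le> Suc n"
  by (auto simp: coface_def)

text \<open>The cosimplicial identity; \<open>i - 1\<close> is a genuine predecessor because
  \<open>j < i\<close>. It supplies the symmetry hypothesis of
  \<open>alternating_double_product\<close>.\<close>

lemma coface_coface: "j < i \<Longrightarrow> coface i (coface j k) = coface j (coface (i - 1) k)"
  by (auto simp: coface_def)

locale category_chain = category +
  fixes \<sigma> and N
  assumes chain: "\<sigma> \<in> chains_of C N"
begin

lemma length_chain [simp]: "length (snd \<sigma>) = N"
  using chain by (auto simp: chains_of_def)

lemma arr_nth: "i < N \<Longrightarrow> snd \<sigma> ! i \<in> Arr C"
  and Cod_nth: "i < N \<Longrightarrow> Cod C (snd \<sigma> ! i) = vertex C \<sigma> i"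
  and Dom_nth: "Dom C (snd \<sigma> ! i) = vertex C \<sigma> (Suc i)"
  using chain by (auto simp: chains_of_iff[OF category_axioms]) (auto simp: vertex_def)

lemma vertex_Obj [simp]: "i \<le> N \<Longrightarrow> vertex C \<sigma> i \<in> Obj C"
  using chain Dom_Obj
  by (cases i) (auto simp: chains_of_iff[OF category_axioms] vertex_def)

lemma segment_refl: "segment C \<sigma> i i = Ident C (vertex C \<sigma> i)"
  by (simp add: segment_def)

text \<open>\<open>list_composite\<close> consumes its list from the head, so segments unfold at
  their left end. For this reason the inductions on segments run downwards on the left index, by
  \<open>inc_induct\<close>.\<close>

lemma segment_step:
  assumes "i < j" "j \<le> N" shows "segment C \<sigma> i j = snd \<sigma> ! i \<bullet> segment C \<sigma> (Suc i) j"
proof -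
  have "drop i (snd \<sigma>) = snd \<sigma> ! i # drop (Suc i) (snd \<sigma>)"
    using assms by (simp add: Cons_nth_drop_Suc)
  moreover have "j - i = Suc (j - Suc i)" using assms by simp
  ultimately show ?thesis by (simp add: segment_def Dom_nth)
qed

lemma segment_hom:
  assumes "i \<le> j" "j \<le> N"
  shows "segment C \<sigma> i j \<in> Arr C \<and> Dom C (segment C \<sigma> i j) = vertex C \<sigma> j
    \<and> Cod C (segment C \<sigma> i j) = vertex C \<sigma> i"
  using assms
proof (induction rule: inc_induct)
  case (step k)
  then show ?case
    by (simp add: segment_step arr_nth Cod_nth Dom_nth)
qed (simp add: segment_refl)

lemma segment_arr [simp]:
  assumes "i \<le> j" "j \<le> N"
  shows "segment C \<sigma> i j \<in> Arr C" "Dom C (segment C \<sigma> i j) = vertex C \<sigma> j"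
    "Cod C (segment C \<sigma> i j) = vertex C \<sigma> i"
  using segment_hom[OF assms] by auto

lemma segment_comp:
  assumes "i \<le> j" "j \<le> k" "k \<le> N"
  shows "segment C \<sigma> i j \<bullet> segment C \<sigma> j k = segment C \<sigma> i k"
  using assms
proof (induction rule: inc_induct)
  case base
  then show ?case by (simp add: segment_refl Ident_left')
next
  case (step l)
  then show ?case
    by (simp add: segment_step arr_nth Cod_nth Dom_nth Comp_assoc)
qed

lemma segment_Suc: "i < N \<Longrightarrow> segment C \<sigma> i (Suc i) = snd \<sigma> ! i"
  by (simp add: segment_step segment_refl Ident_right' arr_nth Dom_nth)

lemma composite_eq_segment: "composite C \<sigma> = segment C \<sigma> 0 N"
  by (simp add: composite_def segment_def vertex_def)

context
  fixes m :: nat and \<theta> :: "nat \<Rightarrow> nat"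
  assumes \<theta>: "mono \<theta>" "\<theta> m \<le> N"
begin

lemma \<theta>_le: "i \<le> j \<Longrightarrow> \<theta> i \<le> \<theta> j" "i \<le> m \<Longrightarrow> \<theta> i \<le> N"
  using \<theta> by (auto dest: monoD intro: order_trans)

lemma vertex_reindex: "k \<le> m \<Longrightarrow> vertex C (reindex C m \<theta> \<sigma>) k = vertex C \<sigma> (\<theta> k)"
  using \<theta>_le
  by (cases k) (auto simp: vertex_def[of C "reindex C m \<theta> \<sigma>"] reindex_nth, simp add: reindex_def)

lemma reindex_chain: "reindex C m \<theta> \<sigma> \<in> chains_of C m"
proof -
  have "fst (reindex C m \<theta> \<sigma>) = vertex C \<sigma> (\<theta> 0)" by (simp add: reindex_def)
  then show ?thesis
    using \<theta>_le vertex_reindex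
    by (auto simp: chains_of_iff[OF category_axioms] reindex_nth)
qed

text \<open>The arrows of the reindexed chain are themselves segments of \<sigma>, and
  \<open>segment_comp\<close> glues adjacent ones.\<close>

lemma segment_reindex:
  assumes "i \<le> j" "j \<le> m"
  shows "segment C (reindex C m \<theta> \<sigma>) i j = segment C \<sigma> (\<theta> i) (\<theta> j)"
proof -
  interpret r: category_chain C "reindex C m \<theta> \<sigma>" m
    by unfold_locales (rule reindex_chain)
  show ?thesis
    using assms
  proof (induction rule: inc_induct)
    case base
    then show ?case by (simp add: r.segment_refl segment_refl vertex_reindex)
  next
    case (step l)
    then show ?case
      by (simp add: r.segment_step reindex_nth segment_comp \<theta>_le)
  qed
qed

lemma composite_reindex: "composite C (reindex C m \<theta> \<sigma>) = segment C \<sigma> (\<theta> 0) (\<theta> m)"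
proof -
  interpret r: category_chain C "reindex C m \<theta> \<sigma>" m
    by unfold_locales (rule reindex_chain)
  show ?thesis by (simp add: r.composite_eq_segment segment_reindex)
qed

lemma reindex_reindex:
  assumes "mono \<psi>" "\<psi> l \<le> m"
  shows "reindex C l \<psi> (reindex C m \<theta> \<sigma>) = reindex C l (\<theta> \<circ> \<psi>) \<sigma>"
proof -
  have "\<psi> i \<le> \<psi> j" if "i \<le> j" for i j using that assms by (auto dest: monoD)
  moreover have "\<psi> i \<le> m" if "i \<le> l" for i using that assms by (auto dest: monoD intro: order_trans)
  ultimately show ?thesis
    by (auto simp: reindex_def[of C l] segment_reindex vertex_reindex)
qed

end

lemma reindex_id: "reindex C N (\<lambda>k. k) \<sigma> = \<sigma>"
proof -
  have "snd (reindex C N (\<lambda>k. k) \<sigma>) = snd \<sigma>"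
    by (rule nth_equalityI) (auto simp: reindex_nth segment_Suc)
  moreover have "fst (reindex C N (\<lambda>k. k) \<sigma>) = fst \<sigma>"
    by (simp add: reindex_def vertex_def)
  ultimately show ?thesis by (simp add: prod_eq_iff)
qed

lemma chain_front_eq_reindex: "n \<le> N \<Longrightarrow> chain_front n \<sigma> = reindex C n (\<lambda>k. k) \<sigma>"
  by (auto simp: chain_front_def prod_eq_iff reindex_nth segment_Suc intro!: nth_equalityI)
    (simp add: reindex_def vertex_def)

lemma chain_back_eq_reindex:
  "n + m = N \<Longrightarrow> chain_back C n \<sigma> = reindex C m (\<lambda>k. n + k) \<sigma>"
  by (auto simp: chain_back_def prod_eq_iff reindex_nth segment_Suc intro!: nth_equalityI)
    (simp_all add: reindex_def vertex_def)

lemma chain_merge_eq_reindex: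
  assumes "1 \<le> i" "i \<le> n" "N = Suc n"
  shows "chain_merge C i \<sigma> = reindex C n (coface i) \<sigma>"
proof -
  have "snd (chain_merge C i \<sigma>) ! k = segment C \<sigma> (coface i k) (coface i (Suc k))" if "k < n" for k
  proof -
    \<comment> \<open>Only at entry \<open>i - 1\<close> does \<open>coface i\<close> jump over a
      vertex, namely \<open>i\<close>; the segment there consists of two arrows, while all later
      entries are shifted by one.\<close>
    consider "k < i - 1" | "k = i - 1" | "k \<ge> i" using \<open>1 \<le> i\<close> by linarith
    then show ?thesis
    proof cases
      case 2
      then show ?thesis using assms
        by (auto simp: chain_merge_def nth_append coface_def segment_step segment_refl Ident_right'
            arr_nth Dom_nth)
    qed (use assms that in \<open>auto simp: chain_merge_def nth_append coface_def segment_Suc nth_Cons'\<close>)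
  qed
  moreover have "length (snd (chain_merge C i \<sigma>)) = n"
    using assms by (simp add: chain_merge_def)
  ultimately have "snd (chain_merge C i \<sigma>) = snd (reindex C n (coface i) \<sigma>)"
    by (intro nth_equalityI) (auto simp: reindex_nth)
  then show ?thesis
    using assms by (simp add: prod_eq_iff) (simp add: chain_merge_def reindex_def coface_def vertex_def)
qed

end

section \<open>Alternating products\<close>


context comm_group
begin

lemma finprod_int_pow:
  assumes "f \<in> A \<rightarrow> carrier G"
  shows "(\<Otimes>i\<in>A. f i) [^] (k :: int) = (\<Otimes>i\<in>A. f i [^] k)"
  using assms
proof (induction A rule: infinite_finite_induct)
  case (insert a A)
  then show ?case by (simp add: int_pow_distrib Pi_iff)
qed (auto simp: finprod_infinite int_pow_one)

text \<open>The algebra behind \<delta>\<delta> = 0, separated from chains. Going from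
  \<open>m\<close> to \<open>m + 1\<close> adds one column, \<open>j = m + 1\<close>, and one row,
  \<open>i = m + 2\<close>; the symmetry matches them entry by entry with opposite signs, and the
  old block is trivial by induction.\<close>

lemma alternating_double_product:
  assumes T: "\<And>i j. T i j \<in> carrier G"
    and sym: "\<And>i j. j < i \<Longrightarrow> i \<le> Suc m \<Longrightarrow> T i j = T j (i - 1)"
  shows "(\<Otimes>i\<in>{..Suc m}. (\<Otimes>j\<in>{..m}. T i j [^] ((-1) ^ j :: int)) [^] ((-1) ^ i :: int)) = \<one>"
  using sym
proof (induction m)
  case 0
  have "T (Suc 0) 0 = T 0 0" using 0[of 0 1] by simp
  then show ?case using T by (simp add: finprod_Suc int_pow_neg)
next
  case (Suc m)
  let ?row = "\<lambda>i j. (T i j [^] ((-1) ^ j :: int)) [^] ((-1) ^ i :: int)"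
  have IH: "(\<Otimes>i\<in>{..Suc m}. (\<Otimes>j\<in>{..m}. T i j [^] ((-1) ^ j :: int)) [^] ((-1) ^ i :: int)) = \<one>"
    using Suc.prems by (intro Suc.IH) auto
  have "(\<Otimes>i\<in>{..Suc m}. (\<Otimes>j\<in>{..Suc m}. T i j [^] ((-1) ^ j :: int)) [^] ((-1) ^ i :: int))
    = (\<Otimes>i\<in>{..Suc m}. (\<Otimes>j\<in>{..m}. T i j [^] ((-1) ^ j :: int)) [^] ((-1) ^ i :: int)
         \<otimes> ?row i (Suc m))"
    using T by (intro finprod_cong') (auto simp del: finprod_Suc simp: finprod_Suc[of _ m] Pi_iff int_pow_distrib m_comm)
  also have "\<dots> = (\<Otimes>i\<in>{..Suc m}. ?row i (Suc m))"
    using T by (simp add: IH Pi_iff del: finprod_Suc)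
  finally have cols: "(\<Otimes>i\<in>{..Suc m}. (\<Otimes>j\<in>{..Suc m}. T i j [^] ((-1) ^ j :: int)) [^] ((-1) ^ i :: int))
    = (\<Otimes>i\<in>{..Suc m}. ?row i (Suc m))" .
  \<comment> \<open>By symmetry the new row has the same entries as the new column. Their signs are
    \<open>(-1)^(j + m + 2)\<close> and \<open>(-1)^(j + m + 1)\<close>, so corresponding entries
    are inverse to each other.\<close>
  have "(\<Otimes>j\<in>{..Suc m}. T (Suc (Suc m)) j [^] ((-1) ^ j :: int)) [^] ((-1) ^ Suc (Suc m) :: int)
    = (\<Otimes>j\<in>{..Suc m}. ?row (Suc (Suc m)) j)"
    using T by (intro finprod_int_pow) auto
  also have "\<dots> = (\<Otimes>i\<in>{..Suc m}. inv (?row i (Suc m)))"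
  proof (intro finprod_cong' refl)
    fix j assume "j \<in> {..Suc m}"
    then have "T (Suc (Suc m)) j = T j (Suc m)" using Suc.prems[of j "Suc (Suc m)"] by simp
    then show "?row (Suc (Suc m)) j = inv (?row j (Suc m))"
      by (simp only: int_pow_pow[OF T] int_pow_neg[OF T, symmetric]) (simp add: mult.commute)
  qed (use T in auto)
  finally have rows: "(\<Otimes>j\<in>{..Suc m}. T (Suc (Suc m)) j [^] ((-1) ^ j :: int)) [^] ((-1) ^ Suc (Suc m) :: int)
    = (\<Otimes>i\<in>{..Suc m}. inv (?row i (Suc m)))" .
  have "(\<Otimes>i\<in>{..Suc (Suc m)}. (\<Otimes>j\<in>{..Suc m}. T i j [^] ((-1) ^ j :: int)) [^] ((-1) ^ i :: int))
    = (\<Otimes>i\<in>{..Suc m}. inv (?row i (Suc m))) \<otimes> (\<Otimes>i\<in>{..Suc m}. ?row i (Suc m))"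
    using T by (subst finprod_Suc) (auto simp only: cols rows Pi_iff intro!: finprod_closed int_pow_closed)
  also have "\<dots> = (\<Otimes>i\<in>{..Suc m}. inv (?row i (Suc m)) \<otimes> ?row i (Suc m))"
    using T by (intro finprod_multf[symmetric]) auto
  also have "\<dots> = \<one>"
    using T by (intro finprod_one_eqI) auto
  finally show ?case .
qed

text \<open>The sign bookkeeping of the Leibniz rule. \<open>A\<close> stands for the faces of a
  product, \<open>B\<close> and \<open>C\<close> for the faces of its two factors. The right side
  has two terms more than the left, \<open>B (Suc n)\<close> with sign \<open>(-1)^(n + 1)\<close>
  and \<open>C 0\<close> with sign \<open>(-1)^n\<close>; they are equal and cancel. This is the
  whole base case, and the induction on \<open>k\<close> only appends further
  \<open>C j\<close>.\<close>

lemma alternating_product_splice: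
  assumes "\<And>i. A i \<in> carrier G" "\<And>i. B i \<in> carrier G" "\<And>i. C i \<in> carrier G"
    and "\<And>i. i \<le> n \<Longrightarrow> A i = B i" "B (Suc n) = C 0" "\<And>j. 1 \<le> j \<Longrightarrow> j \<le> k \<Longrightarrow> A (n + j) = C j"
  shows "(\<Otimes>i\<in>{..n + k}. A i [^] ((-1) ^ i :: int)) =
    (\<Otimes>i\<in>{..Suc n}. B i [^] ((-1) ^ i :: int)) \<otimes>
    (\<Otimes>j\<in>{..k}. C j [^] ((-1) ^ j :: int)) [^] ((-1) ^ n :: int)"
  using assms(6)
proof (induction k)
  case 0
  let ?P = "\<Otimes>i\<in>{..n}. B i [^] ((-1) ^ i :: int)"
  have "(\<Otimes>i\<in>{..n + 0}. A i [^] ((-1) ^ i :: int)) = ?P"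
    using assms by (auto intro!: finprod_cong')
  moreover have "?P \<in> carrier G" using assms by auto
  ultimately show ?case
    using assms by (simp add: Pi_iff int_pow_neg m_assoc m_comm[of _ ?P])
next
  case (Suc k)
  have A: "A (Suc (n + k)) = C (Suc k)" using Suc.prems[of "Suc k"] by simp
  have IH: "(\<Otimes>i\<in>{..n + k}. A i [^] ((-1) ^ i :: int)) =
    (\<Otimes>i\<in>{..Suc n}. B i [^] ((-1) ^ i :: int)) \<otimes>
    (\<Otimes>j\<in>{..k}. C j [^] ((-1) ^ j :: int)) [^] ((-1) ^ n :: int)"
    using Suc.prems by (intro Suc.IH) auto
  have "(\<Otimes>i\<in>{..n + Suc k}. A i [^] ((-1) ^ i :: int)) =
     C (Suc k) [^] ((-1) ^ Suc (n + k) :: int) \<otimes> (\<Otimes>i\<in>{..n + k}. A i [^] ((-1) ^ i :: int))"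
    using assms by (simp add: Pi_iff A)
  also have "\<dots> = (\<Otimes>i\<in>{..Suc n}. B i [^] ((-1) ^ i :: int)) \<otimes>
     (C (Suc k) [^] ((-1) ^ Suc (n + k) :: int) \<otimes> (\<Otimes>j\<in>{..k}. C j [^] ((-1) ^ j :: int)) [^] ((-1) ^ n :: int))"
    unfolding IH using assms by (intro m_lcomm) (auto simp del: finprod_Suc)
  also have "C (Suc k) [^] ((-1) ^ Suc (n + k) :: int) \<otimes> (\<Otimes>j\<in>{..k}. C j [^] ((-1) ^ j :: int)) [^] ((-1) ^ n :: int)
    = (\<Otimes>j\<in>{..Suc k}. C j [^] ((-1) ^ j :: int)) [^] ((-1) ^ n :: int)"
    using assms by (subst finprod_Suc) (auto simp: Pi_iff int_pow_distrib int_pow_pow power_add mult.commute)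
  finally show ?case .
qed

end

lemma hom_finprod:
  assumes "comm_group G" "comm_group H" "h \<in> hom G H" "f \<in> A \<rightarrow> carrier G"
  shows "h (finprod G f A) = finprod H (\<lambda>i. h (f i)) A"
proof -
  interpret G: comm_group G by fact
  interpret H: comm_group H by fact
  interpret group_hom G H h using assms(3) by unfold_locales
  show ?thesis
    using assms(4)
    by (induction A rule: infinite_finite_induct) (auto simp: Pi_iff)
qed

section \<open>The Baues--Wirsching complex\<close>


lemma cochain_group_carrier:
  "carrier (cochain_group C D n) = (\<Pi>\<^sub>E \<sigma>\<in>chains_of C n. carrier (Gr D (composite C \<sigma>)))"
  by (simp add: cochain_group_def)

lemma cochain_mult_apply:
  "\<sigma> \<in> chains_of C n \<Longrightarrow>
    (f \<otimes>\<^bsub>cochain_group C D n\<^esub> g) \<sigma> = f \<sigma> \<otimes>\<^bsub>Gr D (composite C \<sigma>)\<^esub> g \<sigma>"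
  by (simp add: cochain_group_def)

lemma cochain_one_apply:
  "\<sigma> \<in> chains_of C n \<Longrightarrow> \<one>\<^bsub>cochain_group C D n\<^esub> \<sigma> = \<one>\<^bsub>Gr D (composite C \<sigma>)\<^esub>"
  by (simp add: cochain_group_def)

lemma cochain_eqI:
  assumes "f \<in> carrier (cochain_group C D n)" "g \<in> carrier (cochain_group C D n)"
    and "\<And>\<sigma>. \<sigma> \<in> chains_of C n \<Longrightarrow> f \<sigma> = g \<sigma>"
  shows "f = g"
  using assms by (auto simp: cochain_group_carrier intro: PiE_ext)

text \<open>
  The cosimplicial structure \<open>\<theta>\<^sub>* : F\<^sup>m \<rightarrow> F\<^sup>N\<close> for monotone \<open>\<theta> : {0, \<dots>, m} \<rightarrow> {0, \<dots>, N}\<close>: the value on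
  \<open>\<theta>\<^sup>*\<sigma>\<close> is transported along the factorization of the composite of \<open>\<sigma>\<close> through that of \<open>\<theta>\<^sup>*\<sigma>\<close>.
\<close>

definition coact :: "('o, 'm) cat \<Rightarrow> ('m, 'a) nat_sys \<Rightarrow> nat \<Rightarrow> (nat \<Rightarrow> nat) \<Rightarrow>
    ('o, 'm, 'a) cochain \<Rightarrow> ('o, 'm, 'a) cochain" where
  "coact C D m \<theta> f \<sigma> =
     Mp D (segment C \<sigma> (\<theta> 0) (\<theta> m), segment C \<sigma> 0 (\<theta> 0), segment C \<sigma> (\<theta> m) (length (snd \<sigma>)))
       (f (reindex C m \<theta> \<sigma>))"

lemma coact_cong:
  assumes "\<And>k. k \<le> m \<Longrightarrow> \<theta> k = \<psi> k" shows "coact C D m \<theta> f \<sigma> = coact C D m \<psi> f \<sigma>"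
  using assms by (simp add: coact_def cong: reindex_cong)

locale category_natural_system = category +
  fixes D :: "('b, 'c) nat_sys"
  assumes natural_system: "natural_system C D"
begin

abbreviation "F \<equiv> cochain_group C D"
abbreviation "\<delta> \<equiv> delta C D"

lemma comm_group_Gr: "l \<in> Arr C \<Longrightarrow> comm_group (Gr D l)"
  using natural_system by (auto simp: natural_system_def is_ab_functor_def fact_cat_def)

lemma Mp_hom:
  assumes "l \<in> Arr C" "\<alpha> \<in> Arr C" "\<beta> \<in> Arr C" "Dom C \<alpha> = Cod C l" "Cod C \<beta> = Dom C l"
  shows "Mp D (l, \<alpha>, \<beta>) \<in> hom (Gr D l) (Gr D (\<alpha> \<bullet> l \<bullet> \<beta>))"
  using natural_system assms
  unfolding natural_system_def is_ab_functor_def fact_cat_def by auto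

lemma Mp_Ident:
  assumes "l \<in> Arr C" "x \<in> carrier (Gr D l)"
  shows "Mp D (l, Ident C (Cod C l), Ident C (Dom C l)) x = x"
  using natural_system assms
  unfolding natural_system_def is_ab_functor_def fact_cat_def by auto

lemma Mp_Comp:
  assumes "l \<in> Arr C" "\<alpha> \<in> Arr C" "\<beta> \<in> Arr C" "Dom C \<alpha> = Cod C l" "Cod C \<beta> = Dom C l"
    and "\<alpha>' \<in> Arr C" "\<beta>' \<in> Arr C" "Dom C \<alpha>' = Cod C \<alpha>" "Cod C \<beta>' = Dom C \<beta>"
    and "x \<in> carrier (Gr D l)" "k = \<alpha> \<bullet> l \<bullet> \<beta>"
  shows "Mp D (k, \<alpha>', \<beta>') (Mp D (l, \<alpha>, \<beta>) x) = Mp D (l, \<alpha>' \<bullet> \<alpha>, \<beta> \<bullet> \<beta>') x"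
proof -
  let ?F = "fact_cat C"
  have "\<forall>f\<in>Arr ?F. \<forall>g\<in>Arr ?F. Dom ?F g = Cod ?F f \<longrightarrow>
        (\<forall>x\<in>carrier (Gr D (Dom ?F f)). Mp D (g \<bullet>\<^bsub>?F\<^esub> f) x = Mp D g (Mp D f x))"
    using natural_system unfolding natural_system_def is_ab_functor_def by blast
  from this[rule_format, of "(l, \<alpha>, \<beta>)" "(k, \<alpha>', \<beta>')" x] show ?thesis
    using assms by (simp add: fact_cat_def)
qed

lemma composite_arr: "\<sigma> \<in> chains_of C n \<Longrightarrow> composite C \<sigma> \<in> Arr C"
proof -
  assume "\<sigma> \<in> chains_of C n"
  then interpret category_chain C \<sigma> n by unfold_locales
  show ?thesis by (simp add: composite_eq_segment)
qed

lemma comm_group_composite: "\<sigma> \<in> chains_of C n \<Longrightarrow> comm_group (Gr D (composite C \<sigma>))"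
  by (intro comm_group_Gr composite_arr)

lemma group_composite: "\<sigma> \<in> chains_of C n \<Longrightarrow> group (Gr D (composite C \<sigma>))"
  using comm_group_composite comm_group_def by blast

sublocale F: comm_group "F n"
proof -
  interpret group "F n"
    unfolding cochain_group_def by (rule product_group) (rule group_composite)
  show "comm_group (F n)"
  proof (rule group_comm_groupI)
    fix f g assume "f \<in> carrier (F n)" "g \<in> carrier (F n)"
    then have "(f \<otimes>\<^bsub>F n\<^esub> g) \<sigma> = (g \<otimes>\<^bsub>F n\<^esub> f) \<sigma>" if "\<sigma> \<in> chains_of C n" for \<sigma>
      using that comm_group_composite[OF that]
      by (auto simp: cochain_mult_apply cochain_group_carrier PiE_mem intro!: comm_groupE(4))
    with \<open>f \<in> _\<close> \<open>g \<in> _\<close> show "f \<otimes>\<^bsub>F n\<^esub> g = g \<otimes>\<^bsub>F n\<^esub> f"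
      by (intro cochain_eqI[of _ C D n]) auto
  qed
qed

lemma cochain_closed [simp]:
  "f \<in> carrier (F n) \<Longrightarrow> \<sigma> \<in> chains_of C n \<Longrightarrow> f \<sigma> \<in> carrier (Gr D (composite C \<sigma>))"
  by (auto simp: cochain_group_carrier)

lemma cochain_inv_apply:
  "f \<in> carrier (F n) \<Longrightarrow> \<sigma> \<in> chains_of C n \<Longrightarrow>
    (inv\<^bsub>F n\<^esub> f) \<sigma> = inv\<^bsub>Gr D (composite C \<sigma>)\<^esub> f \<sigma>"
  using inv_product_group[of f "chains_of C n" "\<lambda>\<sigma>. Gr D (composite C \<sigma>)"] group_composite
  by (simp add: cochain_group_def)

end

locale coaction = category_chain C \<sigma> N + category_natural_system C D
  for C (structure) and \<sigma> N D +
  fixes m :: nat and \<theta> :: "nat \<Rightarrow> nat"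
  assumes \<theta>: "mono \<theta>" "\<theta> m \<le> N"
begin

lemma \<theta>_le' [simp]: "i \<le> m \<Longrightarrow> \<theta> i \<le> N" "\<theta> 0 \<le> \<theta> m"
  using \<theta>_le[OF \<theta>] by auto

lemma \<theta>_segments [simp]:
  "segment C \<sigma> 0 (\<theta> 0) \<in> Arr C" "Dom C (segment C \<sigma> 0 (\<theta> 0)) = vertex C \<sigma> (\<theta> 0)"
  "segment C \<sigma> (\<theta> 0) (\<theta> m) \<in> Arr C" "Dom C (segment C \<sigma> (\<theta> 0) (\<theta> m)) = vertex C \<sigma> (\<theta> m)"
  "Cod C (segment C \<sigma> (\<theta> 0) (\<theta> m)) = vertex C \<sigma> (\<theta> 0)"
  "segment C \<sigma> (\<theta> m) N \<in> Arr C" "Cod C (segment C \<sigma> (\<theta> m) N) = vertex C \<sigma> (\<theta> m)"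
  by (auto intro: segment_arr)

lemma \<theta>_factorization:
  "segment C \<sigma> 0 (\<theta> 0) \<bullet> segment C \<sigma> (\<theta> 0) (\<theta> m) \<bullet> segment C \<sigma> (\<theta> m) N = composite C \<sigma>"
  by (simp add: segment_comp composite_eq_segment)

lemma coaction_hom:
  "Mp D (segment C \<sigma> (\<theta> 0) (\<theta> m), segment C \<sigma> 0 (\<theta> 0), segment C \<sigma> (\<theta> m) N)
    \<in> hom (Gr D (composite C (reindex C m \<theta> \<sigma>))) (Gr D (composite C \<sigma>))"
  using Mp_hom[of "segment C \<sigma> (\<theta> 0) (\<theta> m)" "segment C \<sigma> 0 (\<theta> 0)" "segment C \<sigma> (\<theta> m) N"]
  by (simp add: composite_reindex[OF \<theta>] \<theta>_factorization)

lemma coact_closed: "f \<in> carrier (F m) \<Longrightarrow> coact C D m \<theta> f \<sigma> \<in> carrier (Gr D (composite C \<sigma>))"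
  using coaction_hom reindex_chain[OF \<theta>] by (auto simp: coact_def hom_def Pi_iff)

lemma coact_mult:
  assumes "f \<in> carrier (F m)" "g \<in> carrier (F m)"
  shows "coact C D m \<theta> (f \<otimes>\<^bsub>F m\<^esub> g) \<sigma> =
    coact C D m \<theta> f \<sigma> \<otimes>\<^bsub>Gr D (composite C \<sigma>)\<^esub> coact C D m \<theta> g \<sigma>"
  using coaction_hom reindex_chain[OF \<theta>] assms
  by (simp add: coact_def cochain_mult_apply hom_mult)

text \<open>Functoriality in \<theta>. The outer transport is kept as a homomorphism applied to a
  value, because \<open>delta_delta\<close> has to move it inside a product over the inner
  faces.\<close>

lemma coact_coact:
  assumes "mono \<psi>" "\<psi> l \<le> m" "f \<in> carrier (F l)"
  shows "Mp D (segment C \<sigma> (\<theta> 0) (\<theta> m), segment C \<sigma> 0 (\<theta> 0), segment C \<sigma> (\<theta> m) N)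
    (coact C D l \<psi> f (reindex C m \<theta> \<sigma>)) = coact C D l (\<theta> \<circ> \<psi>) f \<sigma>"
proof -
  have \<psi>: "\<psi> 0 \<le> \<psi> l" "\<psi> 0 \<le> m" using assms monoD[of \<psi> 0 l] by auto
  have le: "\<theta> 0 \<le> \<theta> (\<psi> 0)" "\<theta> (\<psi> 0) \<le> \<theta> (\<psi> l)" "\<theta> (\<psi> l) \<le> \<theta> m" "\<theta> m \<le> N" "\<theta> (\<psi> 0) \<le> N"
    using \<theta> \<psi> assms by (auto intro: monoD)
  have "reindex C l (\<theta> \<circ> \<psi>) \<sigma> \<in> chains_of C l"
    using \<theta> assms le by (intro reindex_chain) (auto simp: mono_def)
  moreover have "composite C (reindex C l (\<theta> \<circ> \<psi>) \<sigma>) = segment C \<sigma> (\<theta> (\<psi> 0)) (\<theta> (\<psi> l))"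
    using \<theta> assms le composite_reindex[of "\<theta> \<circ> \<psi>" l] by (auto simp: mono_def)
  ultimately have "f (reindex C l (\<theta> \<circ> \<psi>) \<sigma>) \<in> carrier (Gr D (segment C \<sigma> (\<theta> (\<psi> 0)) (\<theta> (\<psi> l))))"
    using assms(3) by (metis cochain_closed)
  then show ?thesis
    using assms \<psi> le unfolding coact_def
    by (simp add: reindex_reindex[OF \<theta>] segment_reindex[OF \<theta>])
      (subst Mp_Comp, auto simp: segment_comp)
qed

end

section \<open>The coboundary as an alternating product of cofaces\<close>

context category_natural_system
begin

context
  fixes \<sigma> n
  assumes \<sigma>: "\<sigma> \<in> chains_of C n"
begin

interpretation category_chain C \<sigma> n
  by unfold_locales (rule \<sigma>)

lemma coact_id: "f \<in> carrier (F n) \<Longrightarrow> coact C D n (\<lambda>k. k) f \<sigma> = f \<sigma>"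
  using Mp_Ident[of "composite C \<sigma>" "f \<sigma>"] \<sigma> cochain_closed[of f n \<sigma>]
  by (simp add: coact_def reindex_id segment_refl composite_arr composite_eq_segment)

end

lemma coact_coface_closed:
  assumes "f \<in> carrier (F n)" "\<sigma> \<in> chains_of C (Suc n)"
  shows "coact C D n (coface i) f \<sigma> \<in> carrier (Gr D (composite C \<sigma>))"
proof -
  interpret coaction C \<sigma> "Suc n" D n "coface i"
    using assms by unfold_locales (auto intro: coface_le)
  show ?thesis using assms by (intro coact_closed)
qed

text \<open>The three kinds of terms in \<open>delta\<close> are all coface actions: the push term
  is coface \<open>0\<close>, the merge terms are cofaces \<open>1\<close> to \<open>n\<close>, and
  the pull term is coface \<open>n + 1\<close>.\<close>

lemma delta_eq:
  assumes f: "f \<in> carrier (F n)" and \<sigma>: "\<sigma> \<in> chains_of C (Suc n)"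
  shows "\<delta> n f \<sigma> = (\<Otimes>\<^bsub>Gr D (composite C \<sigma>)\<^esub>i\<in>{..Suc n}.
    coact C D n (coface i) f \<sigma> [^]\<^bsub>Gr D (composite C \<sigma>)\<^esub> ((-1) ^ i :: int))"
proof -
  interpret category_chain C \<sigma> "Suc n" by unfold_locales (rule \<sigma>)
  define G where "G = Gr D (composite C \<sigma>)"
  interpret G: comm_group G unfolding G_def by (rule comm_group_composite[OF \<sigma>])
  define c where "c i = coact C D n (coface i) f \<sigma>" for i
  have c [simp]: "c i \<in> carrier G" for i
    unfolding c_def G_def using f \<sigma> by (rule coact_coface_closed)
  let ?t = "\<lambda>i. c i [^]\<^bsub>G\<^esub> ((-1) ^ i :: int)"
  have r0: "chain_back C 1 \<sigma> = reindex C n (coface 0) \<sigma>"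
    by (subst chain_back_eq_reindex) (auto intro!: reindex_cong simp: coface_def)
  have rn: "chain_front n \<sigma> = reindex C n (coface (Suc n)) \<sigma>"
    by (subst chain_front_eq_reindex) (auto intro!: reindex_cong simp: coface_def)
  have cf: "coface i n \<le> Suc n" for i by (auto intro: coface_le)
  have hd: "hd (snd \<sigma>) = segment C \<sigma> 0 (Suc 0)" and last: "last (snd \<sigma>) = segment C \<sigma> n (Suc n)"
    using length_chain by (auto simp: segment_Suc hd_conv_nth last_conv_nth simp flip: length_0_conv)
  have 0: "push C D (hd (snd \<sigma>)) (composite C (chain_back C 1 \<sigma>)) (f (chain_back C 1 \<sigma>)) = c 0"
    unfolding r0 hd by (simp add: push_def c_def coact_def composite_reindex cf)
      (simp add: coface_def segment_refl)
  have last: "pull C D (last (snd \<sigma>)) (composite C (chain_front n \<sigma>)) (f (chain_front n \<sigma>)) = c (Suc n)"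
    unfolding rn last by (simp add: pull_def c_def coact_def composite_reindex cf)
      (simp add: coface_def segment_refl)
  \<comment> \<open>An inner face keeps the first and the last vertex, so both outer segments are
    identities and the transport is trivial.\<close>
  have mid: "f (chain_merge C i \<sigma>) = c i" if "i \<in> {1..n}" for i
  proof -
    have r: "chain_merge C i \<sigma> = reindex C n (coface i) \<sigma>"
      using that by (intro chain_merge_eq_reindex) auto
    have "reindex C n (coface i) \<sigma> \<in> chains_of C n" by (intro reindex_chain) (auto simp: cf)
    moreover have "composite C (reindex C n (coface i) \<sigma>) = segment C \<sigma> 0 (Suc n)"
      using that by (subst composite_reindex) (auto simp: coface_def)
    ultimately have "f (reindex C n (coface i) \<sigma>) \<in> carrier (Gr D (segment C \<sigma> 0 (Suc n)))"
      using cochain_closed[OF f, of "reindex C n (coface i) \<sigma>"] by simp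
    then show ?thesis
      using that Mp_Ident[of "segment C \<sigma> 0 (Suc n)" "f (reindex C n (coface i) \<sigma>)"]
      by (simp add: r c_def coact_def) (simp add: coface_def segment_refl)
  qed
  have "{..Suc n} = insert 0 (insert (Suc n) {1..n})" by auto
  then have "(\<Otimes>\<^bsub>G\<^esub>i\<in>{..Suc n}. ?t i) = ?t 0 \<otimes>\<^bsub>G\<^esub> (?t (Suc n) \<otimes>\<^bsub>G\<^esub> (\<Otimes>\<^bsub>G\<^esub>i\<in>{1..n}. ?t i))"
    by (simp del: power_Suc G.finprod_Suc)
  also have "\<dots> = c 0 \<otimes>\<^bsub>G\<^esub> (\<Otimes>\<^bsub>G\<^esub>i\<in>{1..n}. ?t i) \<otimes>\<^bsub>G\<^esub> ?t (Suc n)"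
    by (simp add: G.m_ac Pi_iff del: power_Suc)
  also have "(\<Otimes>\<^bsub>G\<^esub>i\<in>{1..n}. ?t i)
      = (\<Otimes>\<^bsub>G\<^esub>i\<in>{1..n}. f (chain_merge C i \<sigma>) [^]\<^bsub>G\<^esub> ((-1) ^ i :: int))"
    by (intro G.finprod_cong') (auto simp: mid)
  finally show ?thesis
    using \<sigma> by (simp add: delta_def Let_def 0 last c_def G_def del: power_Suc One_nat_def)
qed

lemma delta_closed [simp]: "f \<in> carrier (F n) \<Longrightarrow> \<delta> n f \<in> carrier (F (Suc n))"
proof -
  assume f: "f \<in> carrier (F n)"
  have "\<delta> n f \<sigma> \<in> carrier (Gr D (composite C \<sigma>))" if \<sigma>: "\<sigma> \<in> chains_of C (Suc n)" for \<sigma>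
  proof -
    interpret comm_group "Gr D (composite C \<sigma>)" by (rule comm_group_composite[OF \<sigma>])
    show ?thesis unfolding delta_eq[OF f \<sigma>]
      using coact_coface_closed[OF f \<sigma>] by (intro finprod_closed) auto
  qed
  then show ?thesis by (auto simp: cochain_group_carrier delta_def)
qed

lemma delta_mult:
  assumes f: "f \<in> carrier (F n)" and g: "g \<in> carrier (F n)"
  shows "\<delta> n (f \<otimes>\<^bsub>F n\<^esub> g) = \<delta> n f \<otimes>\<^bsub>F (Suc n)\<^esub> \<delta> n g"
proof (rule cochain_eqI[of _ C D "Suc n"])
  fix \<sigma> assume \<sigma>: "\<sigma> \<in> chains_of C (Suc n)"
  interpret G: comm_group "Gr D (composite C \<sigma>)" by (rule comm_group_composite[OF \<sigma>])
  have "coact C D n (coface i) (f \<otimes>\<^bsub>F n\<^esub> g) \<sigma> =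
    coact C D n (coface i) f \<sigma> \<otimes>\<^bsub>Gr D (composite C \<sigma>)\<^esub> coact C D n (coface i) g \<sigma>" for i
  proof -
    interpret coaction C \<sigma> "Suc n" D n "coface i"
      using \<sigma> by unfold_locales (auto intro: coface_le)
    show ?thesis using f g by (intro coact_mult)
  qed
  then show "\<delta> n (f \<otimes>\<^bsub>F n\<^esub> g) \<sigma> = (\<delta> n f \<otimes>\<^bsub>F (Suc n)\<^esub> \<delta> n g) \<sigma>"
    using f g \<sigma> coact_coface_closed[OF _ \<sigma>]
    by (simp add: delta_eq cochain_mult_apply G.int_pow_distrib Pi_iff del: G.finprod_Suc)
qed (use f g in auto)

sublocale \<delta>: group_hom "F n" "F (Suc n)" "\<delta> n"
  by unfold_locales (auto simp: hom_def delta_mult)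

lemma delta_delta:
  assumes f: "f \<in> carrier (F n)"
  shows "\<delta> (Suc n) (\<delta> n f) = \<one>\<^bsub>F (Suc (Suc n))\<^esub>"
proof (rule cochain_eqI[of _ C D "Suc (Suc n)"])
  fix \<sigma> assume \<sigma>: "\<sigma> \<in> chains_of C (Suc (Suc n))"
  define G where "G = Gr D (composite C \<sigma>)"
  interpret G: comm_group G unfolding G_def by (rule comm_group_composite[OF \<sigma>])
  interpret category_chain C \<sigma> "Suc (Suc n)" by unfold_locales (rule \<sigma>)
  define T where "T i j = coact C D n (coface i \<circ> coface j) f \<sigma>" for i j
  have T: "T i j \<in> carrier G" for i j
  proof -
    interpret coaction C \<sigma> "Suc (Suc n)" D n "coface i \<circ> coface j"
      using \<sigma> by unfold_locales (auto intro!: coface_le simp: mono_def monoD[OF mono_coface])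
    show ?thesis unfolding T_def G_def using f by (intro coact_closed)
  qed
  \<comment> \<open>The outer transport is a homomorphism from the value group at the face to the
    one at \<sigma>; it passes through the inner product and its signs, leaving a double product
    over the entries \<open>T i j\<close>.\<close>
  have "coact C D (Suc n) (coface i) (\<delta> n f) \<sigma> =
      (\<Otimes>\<^bsub>G\<^esub>j\<in>{..Suc n}. T i j [^]\<^bsub>G\<^esub> ((-1) ^ j :: int))" for i
  proof -
    interpret coaction C \<sigma> "Suc (Suc n)" D "Suc n" "coface i"
      using \<sigma> by unfold_locales (auto intro: coface_le)
    let ?h = "Mp D (segment C \<sigma> (coface i 0) (coface i (Suc n)), segment C \<sigma> 0 (coface i 0),
      segment C \<sigma> (coface i (Suc n)) (Suc (Suc n)))"
    let ?\<tau> = "reindex C (Suc n) (coface i) \<sigma>"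
    define G' where "G' = Gr D (composite C ?\<tau>)"
    have \<tau>: "?\<tau> \<in> chains_of C (Suc n)" by (rule reindex_chain[OF \<theta>])
    interpret G': comm_group G' unfolding G'_def by (rule comm_group_composite[OF \<tau>])
    have h: "?h \<in> hom G' G" unfolding G_def G'_def by (rule coaction_hom)
    have cl: "coact C D n (coface j) f ?\<tau> \<in> carrier G'" for j
      unfolding G'_def by (rule coact_coface_closed[OF f \<tau>])
    have "coact C D (Suc n) (coface i) (\<delta> n f) \<sigma> = ?h (\<delta> n f ?\<tau>)"
      by (simp add: coact_def)
    also have "\<dots> = ?h (\<Otimes>\<^bsub>G'\<^esub>j\<in>{..Suc n}. coact C D n (coface j) f ?\<tau> [^]\<^bsub>G'\<^esub> ((-1) ^ j :: int))"
      unfolding G'_def delta_eq[OF f \<tau>] ..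
    also have "\<dots> = (\<Otimes>\<^bsub>G\<^esub>j\<in>{..Suc n}. ?h (coact C D n (coface j) f ?\<tau> [^]\<^bsub>G'\<^esub> ((-1) ^ j :: int)))"
      using h cl by (intro hom_finprod) (auto intro: G.comm_group_axioms G'.comm_group_axioms)
    also have "\<dots> = (\<Otimes>\<^bsub>G\<^esub>j\<in>{..Suc n}. T i j [^]\<^bsub>G\<^esub> ((-1) ^ j :: int))"
    proof (rule G.finprod_cong')
      fix j
      show "?h (coact C D n (coface j) f ?\<tau> [^]\<^bsub>G'\<^esub> ((-1) ^ j :: int)) = T i j [^]\<^bsub>G\<^esub> ((-1) ^ j :: int)"
        using hom_int_pow[OF h cl G'.is_group G.is_group] coact_coact[of "coface j" n f] f
        by (simp add: T_def coface_le)
    qed (use T in auto)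
    finally show ?thesis .
  qed
  then have "\<delta> (Suc n) (\<delta> n f) \<sigma> = (\<Otimes>\<^bsub>G\<^esub>i\<in>{..Suc (Suc n)}.
      (\<Otimes>\<^bsub>G\<^esub>j\<in>{..Suc n}. T i j [^]\<^bsub>G\<^esub> ((-1) ^ j :: int)) [^]\<^bsub>G\<^esub> ((-1) ^ i :: int))"
    using f \<sigma> by (simp add: delta_eq G_def del: G.finprod_Suc)
  also have "\<dots> = \<one>\<^bsub>G\<^esub>"
  proof (rule G.alternating_double_product)
    fix i j :: nat assume "j < i"
    then have "coface i \<circ> coface j = coface j \<circ> coface (i - 1)" by (auto simp: coface_coface)
    then show "T i j = T j (i - 1)" by (simp add: T_def)
  qed (rule T)
  finally show "\<delta> (Suc n) (\<delta> n f) \<sigma> = \<one>\<^bsub>F (Suc (Suc n))\<^esub> \<sigma>"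
    using \<sigma> by (simp add: cochain_one_apply G_def)
qed (use f in auto)

end

section \<open>Cohomology classes and the cup product\<close>


context category_natural_system
begin

lemma cocycles_iff: "z \<in> cocycles C D n \<longleftrightarrow> z \<in> carrier (F n) \<and> \<delta> n z = \<one>\<^bsub>F (Suc n)\<^esub>"
  by (simp add: cocycles_def kernel_def)

lemma subgroup_coboundaries: "subgroup (coboundaries C D n) (F n)"
proof (cases n)
  case (Suc k)
  then show ?thesis using \<delta>.img_is_subgroup[of k] by (simp add: coboundaries_def)
qed (simp add: coboundaries_def F.triv_subgroup)

lemma subgroup_cocycles: "subgroup (cocycles C D n) (F n)"
  unfolding cocycles_def using \<delta>.subgroup_kernel .

lemma coboundaries_closed: "b \<in> coboundaries C D n \<Longrightarrow> b \<in> carrier (F n)"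
  by (rule subgroup.mem_carrier[OF subgroup_coboundaries])

lemma coboundary_cocycle: "b \<in> coboundaries C D n \<Longrightarrow> b \<in> cocycles C D n"
proof (cases n)
  case 0
  moreover assume "b \<in> coboundaries C D n"
  ultimately show ?thesis using \<delta>.hom_one[of 0] by (simp add: coboundaries_def cocycles_iff)
next
  case (Suc k)
  moreover assume "b \<in> coboundaries C D n"
  ultimately show ?thesis by (auto simp: coboundaries_def cocycles_iff delta_delta)
qed

lemma coboundaryI: "a \<in> carrier (F n) \<Longrightarrow> \<delta> n a \<in> coboundaries C D (Suc n)"
  by (simp add: coboundaries_def)

lemma cohomology_class_iff:
  "f \<in> cohomology_class C D n z \<longleftrightarrow> (\<exists>b\<in>coboundaries C D n. f = b \<otimes>\<^bsub>F n\<^esub> z)"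
  by (auto simp: cohomology_class_def r_coset_def)

lemma cohomology_class_mult:
  assumes "b \<in> coboundaries C D n" "z \<in> carrier (F n)"
  shows "cohomology_class C D n (b \<otimes>\<^bsub>F n\<^esub> z) = cohomology_class C D n z"
  using assms coboundaries_closed[OF assms(1)] unfolding cohomology_class_def
  by (subst F.coset_mult_assoc[symmetric])
    (simp_all add: F.coset_join2 subgroup_coboundaries subgroup.subset)

lemma self_cohomology_class:
  assumes "z \<in> carrier (F n)" shows "z \<in> cohomology_class C D n z"
  unfolding cohomology_class_def using assms by (intro F.rcos_self subgroup_coboundaries)

lemma cohomology_class_one: "cohomology_class C D n \<one>\<^bsub>F n\<^esub> = coboundaries C D n"
  using subgroup.subset[OF subgroup_coboundaries]
  by (simp add: cohomology_class_def)

lemma carrier_cohomology: "carrier (cohomology C D n) = cohomology_class C D n ` cocycles C D n"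
  unfolding cohomology_def FactGroup_def RCOSETS_def cohomology_class_def r_coset_def by force

lemma one_cohomology: "\<one>\<^bsub>cohomology C D n\<^esub> = coboundaries C D n"
  by (simp add: cohomology_def)

end

text \<open>Expresses a coaction on a piece of \<sigma> by segments of \<sigma> itself, so that
  terms living on different pieces can be compared.\<close>

lemma (in category_chain) coact_reindex:
  assumes "mono \<theta>" "\<theta> p \<le> N" "mono \<psi>" "\<psi> m \<le> p"
  shows "coact C D m \<psi> f (reindex C p \<theta> \<sigma>) =
    Mp D (segment C \<sigma> (\<theta> (\<psi> 0)) (\<theta> (\<psi> m)), segment C \<sigma> (\<theta> 0) (\<theta> (\<psi> 0)),
      segment C \<sigma> (\<theta> (\<psi> m)) (\<theta> p)) (f (reindex C m (\<theta> \<circ> \<psi>) \<sigma>))"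
proof -
  have "\<psi> 0 \<le> \<psi> m" using assms by (auto dest: monoD)
  then show ?thesis
    using assms by (simp add: coact_def segment_reindex reindex_reindex)
qed

lemma mono_id: "mono (\<lambda>k::nat. k)" and mono_add: "mono ((+) (n::nat))"
  by (auto simp: mono_def)

section \<open>The pairing and the cochain cup product\<close>

locale category_endopairing = category_natural_system +
  fixes \<mu>
  assumes endopairing: "endopairing C D \<mu>"
begin

abbreviation "cupc \<equiv> cup_cochain C \<mu>"

lemma biadditive:
  "l1 \<in> Arr C \<Longrightarrow> l2 \<in> Arr C \<Longrightarrow> Dom C l1 = Cod C l2 \<Longrightarrow>
    biadditive (Gr D l1) (Gr D l2) (Gr D (l1 \<bullet> l2)) (\<mu> l1 l2)"
  using endopairing unfolding endopairing_def by blast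

lemma pairing_left_hom:
  "l1 \<in> Arr C \<Longrightarrow> l2 \<in> Arr C \<Longrightarrow> Dom C l1 = Cod C l2 \<Longrightarrow> y \<in> carrier (Gr D l2) \<Longrightarrow>
    (\<lambda>x. \<mu> l1 l2 x y) \<in> hom (Gr D l1) (Gr D (l1 \<bullet> l2))"
  using biadditive by (auto simp: biadditive_def)

lemma pairing_right_hom:
  "l1 \<in> Arr C \<Longrightarrow> l2 \<in> Arr C \<Longrightarrow> Dom C l1 = Cod C l2 \<Longrightarrow> x \<in> carrier (Gr D l1) \<Longrightarrow>
    \<mu> l1 l2 x \<in> hom (Gr D l2) (Gr D (l1 \<bullet> l2))"
  using biadditive by (auto simp: biadditive_def)

lemma pull_pairing_push:
  assumes "l1 \<in> Arr C" "g \<in> Arr C" "l2 \<in> Arr C" "Dom C l1 = Cod C g" "Dom C g = Cod C l2"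
    and "x \<in> carrier (Gr D l1)" "y \<in> carrier (Gr D l2)"
  shows "\<mu> (l1 \<bullet> g) l2 (pull C D g l1 x) y = \<mu> l1 (g \<bullet> l2) x (push C D g l2 y)"
  using endopairing assms unfolding endopairing_def by blast

lemma push_pairing:
  assumes "f \<in> Arr C" "l1 \<in> Arr C" "l2 \<in> Arr C" "Dom C f = Cod C l1" "Dom C l1 = Cod C l2"
    and "x \<in> carrier (Gr D l1)" "y \<in> carrier (Gr D l2)"
  shows "push C D f (l1 \<bullet> l2) (\<mu> l1 l2 x y) = \<mu> (f \<bullet> l1) l2 (push C D f l1 x) y"
  using endopairing assms unfolding endopairing_def by blast

lemma pull_pairing:
  assumes "l1 \<in> Arr C" "l2 \<in> Arr C" "h \<in> Arr C" "Dom C l1 = Cod C l2" "Dom C l2 = Cod C h"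
    and "x \<in> carrier (Gr D l1)" "y \<in> carrier (Gr D l2)"
  shows "pull C D h (l1 \<bullet> l2) (\<mu> l1 l2 x y) = \<mu> l1 (l2 \<bullet> h) x (pull C D h l2 y)"
  using endopairing assms unfolding endopairing_def by blast

lemma pairing_closed:
  "l1 \<in> Arr C \<Longrightarrow> l2 \<in> Arr C \<Longrightarrow> Dom C l1 = Cod C l2 \<Longrightarrow> x \<in> carrier (Gr D l1) \<Longrightarrow>
    y \<in> carrier (Gr D l2) \<Longrightarrow> \<mu> l1 l2 x y \<in> carrier (Gr D (l1 \<bullet> l2))"
  using pairing_right_hom by (meson hom_in_carrier)

text \<open>The arrow (\<alpha>, \<beta>) is (\<alpha>, id) followed by (id, \<beta>): the push is
  absorbed by the left argument, then the pull by the right one.\<close>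

lemma Mp_pairing:
  assumes "\<alpha> \<in> Arr C" "l1 \<in> Arr C" "l2 \<in> Arr C" "\<beta> \<in> Arr C"
    and "Dom C \<alpha> = Cod C l1" "Dom C l1 = Cod C l2" "Dom C l2 = Cod C \<beta>"
    and x: "x \<in> carrier (Gr D l1)" and y: "y \<in> carrier (Gr D l2)"
  shows "Mp D (l1 \<bullet> l2, \<alpha>, \<beta>) (\<mu> l1 l2 x y) =
    \<mu> (\<alpha> \<bullet> l1) (l2 \<bullet> \<beta>) (push C D \<alpha> l1 x) (pull C D \<beta> l2 y)"
proof -
  have x': "push C D \<alpha> l1 x \<in> carrier (Gr D (\<alpha> \<bullet> l1))"
    using Mp_hom[of l1 \<alpha> "Ident C (Dom C l1)"] assms Dom_Obj[of l1]
    by (simp add: push_def Ident_right' hom_in_carrier)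
  have "Mp D (l1 \<bullet> l2, \<alpha>, \<beta>) (\<mu> l1 l2 x y) =
      pull C D \<beta> (\<alpha> \<bullet> (l1 \<bullet> l2)) (push C D \<alpha> (l1 \<bullet> l2) (\<mu> l1 l2 x y))"
    using assms Dom_Obj[of l2] Cod_Obj[of \<alpha>] pairing_closed[OF assms(2,3,6) x y]
    unfolding push_def pull_def
    by (subst Mp_Comp) (simp_all add: Ident_right' Ident_left')
  also have "\<dots> = pull C D \<beta> ((\<alpha> \<bullet> l1) \<bullet> l2) (\<mu> (\<alpha> \<bullet> l1) l2 (push C D \<alpha> l1 x) y)"
    using assms by (simp add: push_pairing Comp_assoc)
  also have "\<dots> = \<mu> (\<alpha> \<bullet> l1) (l2 \<bullet> \<beta>) (push C D \<alpha> l1 x) (pull C D \<beta> l2 y)"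
    using assms x' by (intro pull_pairing) auto
  finally show ?thesis .
qed

lemma cupc_apply:
  assumes "\<sigma> \<in> chains_of C N" "n + m = N"
  shows "cupc n m f g \<sigma> = \<mu> (segment C \<sigma> 0 n) (segment C \<sigma> n N)
    (f (reindex C n (\<lambda>k. k) \<sigma>)) (g (reindex C m (\<lambda>k. n + k) \<sigma>))"
proof -
  interpret category_chain C \<sigma> N by unfold_locales fact
  show ?thesis using assms
    by (auto simp: cup_cochain_def chain_front_eq_reindex chain_back_eq_reindex composite_reindex
        mono_id mono_add)
qed

lemma cochain_reindex:
  assumes "\<sigma> \<in> chains_of C N" "f \<in> carrier (F n)" "mono \<theta>" "\<theta> n \<le> N"
  shows "f (reindex C n \<theta> \<sigma>) \<in> carrier (Gr D (segment C \<sigma> (\<theta> 0) (\<theta> n)))"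
proof -
  interpret category_chain C \<sigma> N by unfold_locales fact
  show ?thesis
    using cochain_closed[OF assms(2) reindex_chain[OF assms(3,4)]]
    by (simp add: composite_reindex[OF assms(3,4)])
qed

lemma cupc_closed:
  assumes "f \<in> carrier (F n)" "g \<in> carrier (F m)"
  shows "cupc n m f g \<in> carrier (F (n + m))"
proof -
  have "cupc n m f g \<sigma> \<in> carrier (Gr D (composite C \<sigma>))" if \<sigma>: "\<sigma> \<in> chains_of C (n + m)" for \<sigma>
  proof -
    interpret category_chain C \<sigma> "n + m" by unfold_locales fact
    show ?thesis
      using cochain_reindex[OF \<sigma> assms(1), where \<theta> = "\<lambda>k. k"] cochain_reindex[OF \<sigma> assms(2), where \<theta> = "\<lambda>k. n + k"]
        pairing_closed[of "segment C \<sigma> 0 n" "segment C \<sigma> n (n + m)"]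
      by (simp add: cupc_apply[OF \<sigma> refl] mono_id mono_add composite_eq_segment segment_comp)
  qed
  then show ?thesis by (auto simp: cochain_group_carrier cup_cochain_def)
qed

text \<open>If \<theta> sends the splitting vertex \<open>n\<close> to \<open>p\<close>, the
  acted-on product splits at \<open>p\<close>: the front factor sees \<theta>, the back factor sees
  \<theta> renumbered from \<open>p\<close>. Monotonicity gives
  \<open>\<theta> (n + k) \<ge> p\<close>, so the natural-number subtraction is exact. For a coface,
  \<open>p\<close> is \<open>n + 1\<close> or \<open>n\<close>, according to whether the omitted
  vertex is at most \<open>n\<close> or beyond it.\<close>

lemma coact_cupc:
  assumes \<sigma>: "\<sigma> \<in> chains_of C N" and f: "f \<in> carrier (F n)" and g: "g \<in> carrier (F m)"
    and \<theta>: "mono \<theta>" "\<theta> (n + m) \<le> N" and pq: "\<theta> n = p" "p + q = N"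
  shows "coact C D (n + m) \<theta> (cupc n m f g) \<sigma> =
    \<mu> (segment C \<sigma> 0 p) (segment C \<sigma> p N)
      (coact C D n \<theta> f (reindex C p (\<lambda>k. k) \<sigma>))
      (coact C D m (\<lambda>k. \<theta> (n + k) - p) g (reindex C q (\<lambda>k. p + k) \<sigma>))"
proof -
  interpret category_chain C \<sigma> N by unfold_locales fact
  have le: "\<theta> 0 \<le> p" "p \<le> \<theta> (n + m)"
    using monoD[OF \<theta>(1), of 0 n] monoD[OF \<theta>(1), of n "n + m"] pq(1) by simp_all
  have shift: "p \<le> \<theta> (n + k)" for k
    using monoD[OF \<theta>(1), of n "n + k"] pq(1) by simp
  have mono: "mono (\<lambda>k. \<theta> (n + k))" "mono (\<lambda>k. \<theta> (n + k) - p)"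
    using monoD[OF \<theta>(1)] by (simp_all add: monoI diff_le_mono)
  have comp: "(\<lambda>k. p + k) \<circ> (\<lambda>k. \<theta> (n + k) - p) = (\<lambda>k. \<theta> (n + k))" "(\<lambda>k. k) \<circ> \<theta> = \<theta>"
    "\<theta> \<circ> (\<lambda>k. n + k) = (\<lambda>k. \<theta> (n + k))" "\<theta> \<circ> (\<lambda>k. k) = \<theta>"
    by (simp_all add: fun_eq_iff shift)
  have \<tau>: "reindex C (n + m) \<theta> \<sigma> \<in> chains_of C (n + m)"
    using \<theta> by (rule reindex_chain)
  have x: "f (reindex C n \<theta> \<sigma>) \<in> carrier (Gr D (segment C \<sigma> (\<theta> 0) p))"
    using cochain_reindex[OF \<sigma> f \<theta>(1)] pq by simp
  have y: "g (reindex C m (\<lambda>k. \<theta> (n + k)) \<sigma>) \<in> carrier (Gr D (segment C \<sigma> p (\<theta> (n + m))))"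
    using cochain_reindex[OF \<sigma> g mono(1) \<theta>(2)] pq(1) by simp
  have "coact C D (n + m) \<theta> (cupc n m f g) \<sigma> =
    Mp D (segment C \<sigma> (\<theta> 0) p \<bullet> segment C \<sigma> p (\<theta> (n + m)), segment C \<sigma> 0 (\<theta> 0), segment C \<sigma> (\<theta> (n + m)) N)
     (\<mu> (segment C \<sigma> (\<theta> 0) p) (segment C \<sigma> p (\<theta> (n + m)))
       (f (reindex C n \<theta> \<sigma>)) (g (reindex C m (\<lambda>k. \<theta> (n + k)) \<sigma>)))"
    using le \<theta> pq
    by (simp add: coact_def cupc_apply[OF \<tau> refl] segment_reindex reindex_reindex segment_comp
        mono_id mono_add comp)
  also have "\<dots> = \<mu> (segment C \<sigma> 0 p) (segment C \<sigma> p N)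
      (push C D (segment C \<sigma> 0 (\<theta> 0)) (segment C \<sigma> (\<theta> 0) p) (f (reindex C n \<theta> \<sigma>)))
      (pull C D (segment C \<sigma> (\<theta> (n + m)) N) (segment C \<sigma> p (\<theta> (n + m))) (g (reindex C m (\<lambda>k. \<theta> (n + k)) \<sigma>)))"
    using le \<theta> x y by (subst Mp_pairing) (auto simp: segment_comp)
  also have "push C D (segment C \<sigma> 0 (\<theta> 0)) (segment C \<sigma> (\<theta> 0) p) (f (reindex C n \<theta> \<sigma>)) =
      coact C D n \<theta> f (reindex C p (\<lambda>k. k) \<sigma>)"
    using le \<theta> pq by (subst coact_reindex) (auto simp: push_def segment_refl comp mono_id mono_add)
  also have "pull C D (segment C \<sigma> (\<theta> (n + m)) N) (segment C \<sigma> p (\<theta> (n + m))) (g (reindex C m (\<lambda>k. \<theta> (n + k)) \<sigma>)) =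
      coact C D m (\<lambda>k. \<theta> (n + k) - p) g (reindex C q (\<lambda>k. p + k) \<sigma>)"
    using le \<theta> pq mono
    by (subst coact_reindex) (auto simp: pull_def segment_refl comp mono_id mono_add)
  finally show ?thesis .
qed

end


section \<open>The Leibniz rule and the descent of the cup product to cohomology\<close>

context category_endopairing
begin

lemma cupc_mult_left:
  assumes "f \<in> carrier (F n)" "f' \<in> carrier (F n)" "g \<in> carrier (F m)"
  shows "cupc n m (f \<otimes>\<^bsub>F n\<^esub> f') g = cupc n m f g \<otimes>\<^bsub>F (n + m)\<^esub> cupc n m f' g"
proof (rule cochain_eqI[of _ C D "n + m"])
  fix \<sigma> assume \<sigma>: "\<sigma> \<in> chains_of C (n + m)"
  interpret category_chain C \<sigma> "n + m" by unfold_locales fact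
  show "cupc n m (f \<otimes>\<^bsub>F n\<^esub> f') g \<sigma> = (cupc n m f g \<otimes>\<^bsub>F (n + m)\<^esub> cupc n m f' g) \<sigma>"
    using cochain_reindex[OF \<sigma> assms(1) mono_id] cochain_reindex[OF \<sigma> assms(2) mono_id]
      cochain_reindex[OF \<sigma> assms(3) mono_add, of n]
      pairing_left_hom[of "segment C \<sigma> 0 n" "segment C \<sigma> n (n + m)"]
      reindex_chain[OF mono_id, of n] composite_reindex[OF mono_id, of n]
    by (simp add: cochain_mult_apply[OF \<sigma>])
      (simp add: cupc_apply[OF \<sigma>] cochain_mult_apply hom_def segment_comp composite_eq_segment)
qed (use assms in \<open>auto intro: cupc_closed\<close>)

lemma cupc_mult_right:
  assumes "f \<in> carrier (F n)" "g \<in> carrier (F m)" "g' \<in> carrier (F m)"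
  shows "cupc n m f (g \<otimes>\<^bsub>F m\<^esub> g') = cupc n m f g \<otimes>\<^bsub>F (n + m)\<^esub> cupc n m f g'"
proof (rule cochain_eqI[of _ C D "n + m"])
  fix \<sigma> assume \<sigma>: "\<sigma> \<in> chains_of C (n + m)"
  interpret category_chain C \<sigma> "n + m" by unfold_locales fact
  show "cupc n m f (g \<otimes>\<^bsub>F m\<^esub> g') \<sigma> = (cupc n m f g \<otimes>\<^bsub>F (n + m)\<^esub> cupc n m f g') \<sigma>"
    using cochain_reindex[OF \<sigma> assms(1) mono_id] cochain_reindex[OF \<sigma> assms(2) mono_add, of n]
      cochain_reindex[OF \<sigma> assms(3) mono_add, of n]
      pairing_right_hom[of "segment C \<sigma> 0 n" "segment C \<sigma> n (n + m)"]
      reindex_chain[OF mono_add, of n m] composite_reindex[OF mono_add, of n m]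
    by (simp add: cochain_mult_apply[OF \<sigma>])
      (simp add: cupc_apply[OF \<sigma>] cochain_mult_apply hom_def segment_comp composite_eq_segment)
qed (use assms in \<open>auto intro: cupc_closed\<close>)

text \<open>Additivity makes the product equal to its own double, and in a group only the neutral
  element has this property.\<close>

lemma cupc_one_left:
  assumes "g \<in> carrier (F m)" shows "cupc n m \<one>\<^bsub>F n\<^esub> g = \<one>\<^bsub>F (n + m)\<^esub>"
  using cupc_mult_left[of "\<one>\<^bsub>F n\<^esub>" n "\<one>\<^bsub>F n\<^esub>" g m] cupc_closed[of "\<one>\<^bsub>F n\<^esub>" n g m] assms
  by simp

lemma cupc_one_right:
  assumes "f \<in> carrier (F n)" shows "cupc n m f \<one>\<^bsub>F m\<^esub> = \<one>\<^bsub>F (n + m)\<^esub>"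
  using cupc_mult_right[of f n "\<one>\<^bsub>F m\<^esub>" m "\<one>\<^bsub>F m\<^esub>"] cupc_closed[of f n "\<one>\<^bsub>F m\<^esub>" m] assms
  by simp

text \<open>Faces of the product with index at most \<open>n\<close> act on the first factor, those
  with index above \<open>n\<close> on the second; \<open>alternating_product_splice\<close>
  assembles them. The rule is stated at one chain, where the sign is an integer power in a single
  value group.\<close>

lemma leibniz:
  assumes f: "f \<in> carrier (F n)" and g: "g \<in> carrier (F m)"
    and \<sigma>: "\<sigma> \<in> chains_of C (Suc (n + m))"
  shows "\<delta> (n + m) (cupc n m f g) \<sigma> = cupc (Suc n) m (\<delta> n f) g \<sigma>
    \<otimes>\<^bsub>Gr D (composite C \<sigma>)\<^esub> cupc n (Suc m) f (\<delta> m g) \<sigma> [^]\<^bsub>Gr D (composite C \<sigma>)\<^esub> ((-1) ^ n :: int)"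
proof -
  interpret category_chain C \<sigma> "Suc (n + m)" by unfold_locales fact
  define G where "G = Gr D (composite C \<sigma>)"
  interpret G: comm_group G unfolding G_def by (rule comm_group_composite[OF \<sigma>])
  let ?N = "Suc (n + m)"
  let ?s = "segment C \<sigma>"
  let ?f1 = "reindex C (Suc n) (\<lambda>k. k) \<sigma>" and ?b1 = "reindex C m ((+) (Suc n)) \<sigma>"
  let ?f0 = "reindex C n (\<lambda>k. k) \<sigma>" and ?b0 = "reindex C (Suc m) ((+) n) \<sigma>"
  have chains: "?f1 \<in> chains_of C (Suc n)" "?b1 \<in> chains_of C m"
      "?f0 \<in> chains_of C n" "?b0 \<in> chains_of C (Suc m)"
    by (auto intro!: reindex_chain monoI)
  have comps: "composite C ?f1 = ?s 0 (Suc n)" "composite C ?b1 = ?s (Suc n) ?N"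
      "composite C ?f0 = ?s 0 n" "composite C ?b0 = ?s n ?N"
    by (subst composite_reindex; auto intro: monoI)+
  define A where "A i = coact C D (n + m) (coface i) (cupc n m f g) \<sigma>" for i
  define B where "B i = \<mu> (?s 0 (Suc n)) (?s (Suc n) ?N) (coact C D n (coface i) f ?f1) (g ?b1)" for i
  define K where "K j = \<mu> (?s 0 n) (?s n ?N) (f ?f0) (coact C D m (coface j) g ?b0)" for j
  have gb1: "g ?b1 \<in> carrier (Gr D (?s (Suc n) ?N))" and ff0: "f ?f0 \<in> carrier (Gr D (?s 0 n))"
    using cochain_closed[OF g chains(2)] cochain_closed[OF f chains(3)] by (simp_all only: comps)
  have cf: "coact C D n (coface i) f ?f1 \<in> carrier (Gr D (?s 0 (Suc n)))" for i
    using coact_coface_closed[OF f chains(1)] by (simp only: comps)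
  have cg: "coact C D m (coface i) g ?b0 \<in> carrier (Gr D (?s n ?N))" for i
    using coact_coface_closed[OF g chains(4)] by (simp only: comps)
  have G1: "G = Gr D (?s 0 (Suc n) \<bullet> ?s (Suc n) ?N)" and G0: "G = Gr D (?s 0 n \<bullet> ?s n ?N)"
    by (simp_all add: segment_comp G_def composite_eq_segment)
  have A: "A i \<in> carrier G" for i
    unfolding A_def G_def using \<sigma> cupc_closed[OF f g] by (intro coact_coface_closed)
  have B: "B i \<in> carrier G" for i
    unfolding B_def G1 using gb1 cf by (intro pairing_closed) auto
  have K: "K i \<in> carrier G" for i
    unfolding K_def G0 using ff0 cg by (intro pairing_closed) auto

  \<comment> \<open>For \<open>i \<le> n\<close> the vertex \<open>n\<close> moves to
    \<open>n + 1\<close>; on the back piece the renumbered coface is the identity.\<close>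
  have AB: "A i = B i" if "i \<le> n" for i
  proof -
    have "A i = \<mu> (?s 0 (Suc n)) (?s (Suc n) ?N) (coact C D n (coface i) f ?f1)
        (coact C D m (\<lambda>k. coface i (n + k) - Suc n) g ?b1)"
      unfolding A_def using that
      by (intro coact_cupc[OF \<sigma> f g mono_coface]) (auto simp: coface_def)
    also have "coact C D m (\<lambda>k. coface i (n + k) - Suc n) g ?b1 = coact C D m (\<lambda>k. k) g ?b1"
      using that by (intro coact_cong) (auto simp: coface_def)
    finally show ?thesis using coact_id[OF chains(2) g] by (simp add: B_def)
  qed
  \<comment> \<open>For indices above \<open>n\<close> the vertex \<open>n\<close> stays fixed; the
    coface is the identity on the front piece and becomes \<open>coface j\<close> on the back
    piece.\<close>
  have AK: "A (n + j) = K j" if "1 \<le> j" for j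
  proof -
    have "A (n + j) = \<mu> (?s 0 n) (?s n ?N) (coact C D n (coface (n + j)) f ?f0)
        (coact C D m (\<lambda>k. coface (n + j) (n + k) - n) g ?b0)"
      unfolding A_def using that
      by (intro coact_cupc[OF \<sigma> f g mono_coface]) (auto simp: coface_def)
    also have "coact C D n (coface (n + j)) f ?f0 = coact C D n (\<lambda>k. k) f ?f0"
      using that by (intro coact_cong) (auto simp: coface_def)
    also have "coact C D m (\<lambda>k. coface (n + j) (n + k) - n) g ?b0 = coact C D m (coface j) g ?b0"
      using that by (intro coact_cong) (auto simp: coface_def)
    finally show ?thesis using coact_id[OF chains(3) f] by (simp add: K_def)
  qed
  \<comment> \<open>The last face of the front piece and the first face of the back piece both
    involve the arrow from vertex \<open>n + 1\<close> to vertex \<open>n\<close>: one pulls along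
    it, the other pushes. Their equality is the middle axiom of the endopairing.\<close>
  have BK: "B (Suc n) = K 0"
  proof -
    have r: "reindex C n (coface (Suc n)) \<sigma> = ?f0"
      by (rule reindex_cong) (simp add: coface_def)
    have r': "(+) n \<circ> coface 0 = (+) (Suc n)" "(\<lambda>k. k) \<circ> coface (Suc n) = coface (Suc n)"
      by (auto simp: coface_def)
    have f1: "coact C D n (coface (Suc n)) f ?f1 = pull C D (?s n (Suc n)) (?s 0 n) (f ?f0)"
      by (subst coact_reindex, simp_all add: mono_id coface_le r' r)
        (simp add: coface_def pull_def segment_refl)
    have g0: "coact C D m (coface 0) g ?b0 = push C D (?s n (Suc n)) (?s (Suc n) ?N) (g ?b1)"
      by (subst coact_reindex, simp_all add: mono_add coface_le r')
        (simp add: coface_def push_def segment_refl)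
    show ?thesis
      using pull_pairing_push[of "?s 0 n" "?s n (Suc n)" "?s (Suc n) ?N" "f ?f0" "g ?b1"] ff0 gb1
      by (simp add: B_def K_def f1 g0 segment_comp)
  qed
  \<comment> \<open>Additivity in the left argument carries the alternating product for \<delta> f
    through the pairing; \<open>dK\<close> does the same on the right.\<close>
  have dB: "cupc (Suc n) m (\<delta> n f) g \<sigma> = (\<Otimes>\<^bsub>G\<^esub>i\<in>{..Suc n}. B i [^]\<^bsub>G\<^esub> ((-1) ^ i :: int))"
  proof -
    let ?H = "Gr D (?s 0 (Suc n))"
    interpret H: comm_group ?H by (rule comm_group_Gr) simp
    have h: "(\<lambda>x. \<mu> (?s 0 (Suc n)) (?s (Suc n) ?N) x (g ?b1)) \<in> hom ?H G"
      unfolding G1 using gb1 by (intro pairing_left_hom) auto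
    have "cupc (Suc n) m (\<delta> n f) g \<sigma> = \<mu> (?s 0 (Suc n)) (?s (Suc n) ?N) (\<delta> n f ?f1) (g ?b1)"
      using \<sigma> by (subst cupc_apply[of _ ?N]) simp_all
    also have "\<delta> n f ?f1 = (\<Otimes>\<^bsub>?H\<^esub>i\<in>{..Suc n}. coact C D n (coface i) f ?f1 [^]\<^bsub>?H\<^esub> ((-1) ^ i :: int))"
      unfolding delta_eq[OF f chains(1)] comps ..
    also have "\<mu> (?s 0 (Suc n)) (?s (Suc n) ?N) \<dots> (g ?b1) =
      (\<Otimes>\<^bsub>G\<^esub>i\<in>{..Suc n}. \<mu> (?s 0 (Suc n)) (?s (Suc n) ?N)
        (coact C D n (coface i) f ?f1 [^]\<^bsub>?H\<^esub> ((-1) ^ i :: int)) (g ?b1))"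
      using cf by (intro hom_finprod[OF H.comm_group_axioms G.comm_group_axioms h]) auto
    also have "\<dots> = (\<Otimes>\<^bsub>G\<^esub>i\<in>{..Suc n}. B i [^]\<^bsub>G\<^esub> ((-1) ^ i :: int))"
      using hom_int_pow[OF h cf H.is_group G.is_group] B
      by (intro G.finprod_cong') (auto simp: B_def)
    finally show ?thesis .
  qed
  have dK: "cupc n (Suc m) f (\<delta> m g) \<sigma> = (\<Otimes>\<^bsub>G\<^esub>i\<in>{..Suc m}. K i [^]\<^bsub>G\<^esub> ((-1) ^ i :: int))"
  proof -
    let ?H = "Gr D (?s n ?N)"
    interpret H: comm_group ?H by (rule comm_group_Gr) simp
    have h: "(\<lambda>y. \<mu> (?s 0 n) (?s n ?N) (f ?f0) y) \<in> hom ?H G"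
      unfolding G0 using ff0 by (intro pairing_right_hom) auto
    have "cupc n (Suc m) f (\<delta> m g) \<sigma> = \<mu> (?s 0 n) (?s n ?N) (f ?f0) (\<delta> m g ?b0)"
      using \<sigma> by (subst cupc_apply[of _ ?N]) simp_all
    also have "\<delta> m g ?b0 = (\<Otimes>\<^bsub>?H\<^esub>i\<in>{..Suc m}. coact C D m (coface i) g ?b0 [^]\<^bsub>?H\<^esub> ((-1) ^ i :: int))"
      unfolding delta_eq[OF g chains(4)] comps ..
    also have "\<mu> (?s 0 n) (?s n ?N) (f ?f0) \<dots> =
      (\<Otimes>\<^bsub>G\<^esub>i\<in>{..Suc m}. \<mu> (?s 0 n) (?s n ?N) (f ?f0)
        (coact C D m (coface i) g ?b0 [^]\<^bsub>?H\<^esub> ((-1) ^ i :: int)))"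
      using cg by (intro hom_finprod[OF H.comm_group_axioms G.comm_group_axioms h]) auto
    also have "\<dots> = (\<Otimes>\<^bsub>G\<^esub>i\<in>{..Suc m}. K i [^]\<^bsub>G\<^esub> ((-1) ^ i :: int))"
      using hom_int_pow[OF h cg H.is_group G.is_group] K
      by (intro G.finprod_cong') (auto simp: K_def)
    finally show ?thesis .
  qed
  have "\<delta> (n + m) (cupc n m f g) \<sigma> = (\<Otimes>\<^bsub>G\<^esub>i\<in>{..n + Suc m}. A i [^]\<^bsub>G\<^esub> ((-1) ^ i :: int))"
    using delta_eq[OF cupc_closed[OF f g] \<sigma>] by (simp add: A_def G_def del: G.finprod_Suc)
  also have "\<dots> = (\<Otimes>\<^bsub>G\<^esub>i\<in>{..Suc n}. B i [^]\<^bsub>G\<^esub> ((-1) ^ i :: int)) \<otimes>\<^bsub>G\<^esub>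
      (\<Otimes>\<^bsub>G\<^esub>j\<in>{..Suc m}. K j [^]\<^bsub>G\<^esub> ((-1) ^ j :: int)) [^]\<^bsub>G\<^esub> ((-1) ^ n :: int)"
    by (rule G.alternating_product_splice) (auto simp: A B K AB AK BK)
  finally show ?thesis unfolding dB dK G_def .
qed

lemma cupc_cocycle_left:
  assumes f: "f \<in> cocycles C D n" and g: "g \<in> carrier (F m)" and \<sigma>: "\<sigma> \<in> chains_of C (Suc (n + m))"
  shows "\<delta> (n + m) (cupc n m f g) \<sigma> =
    cupc n (Suc m) f (\<delta> m g) \<sigma> [^]\<^bsub>Gr D (composite C \<sigma>)\<^esub> ((-1) ^ n :: int)"
proof -
  interpret G: comm_group "Gr D (composite C \<sigma>)" by (rule comm_group_composite[OF \<sigma>])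
  have "cupc n (Suc m) f (\<delta> m g) \<in> carrier (F (Suc (n + m)))"
    using cupc_closed[of f n "\<delta> m g" "Suc m"] f g by (simp add: cocycles_iff)
  then show ?thesis
    using leibniz[OF _ g \<sigma>, of f] f g \<sigma> cupc_one_left[OF g, of "Suc n"]
    by (simp add: cocycles_iff cochain_one_apply)
qed

lemma cupc_cocycle_right:
  assumes f: "f \<in> carrier (F n)" and g: "g \<in> cocycles C D m"
  shows "\<delta> (n + m) (cupc n m f g) = cupc (Suc n) m (\<delta> n f) g"
proof (rule cochain_eqI[of _ C D "Suc (n + m)"])
  fix \<sigma> assume \<sigma>: "\<sigma> \<in> chains_of C (Suc (n + m))"
  interpret G: comm_group "Gr D (composite C \<sigma>)" by (rule comm_group_composite[OF \<sigma>])
  have "cupc (Suc n) m (\<delta> n f) g \<in> carrier (F (Suc (n + m)))"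
    using cupc_closed[of "\<delta> n f" "Suc n" g m] f g by (simp add: cocycles_iff)
  then show "\<delta> (n + m) (cupc n m f g) \<sigma> = cupc (Suc n) m (\<delta> n f) g \<sigma>"
    using leibniz[OF f _ \<sigma>, of g] f g \<sigma> cupc_one_right[OF f, of "Suc m"]
    by (simp add: cocycles_iff cochain_one_apply)
qed (use assms cupc_closed[of f n g m] cupc_closed[of "\<delta> n f" "Suc n" g m] in \<open>auto simp: cocycles_iff\<close>)

lemma cupc_cocycles:
  assumes "f \<in> cocycles C D n" "g \<in> cocycles C D m"
  shows "cupc n m f g \<in> cocycles C D (n + m)"
  using cupc_cocycle_right[of f n g m] assms cupc_closed[of f n g m] cupc_one_left[of g m "Suc n"]
  by (simp add: cocycles_iff)

lemma cupc_coboundary_left: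
  assumes b: "b \<in> coboundaries C D n" and g: "g \<in> cocycles C D m"
  shows "cupc n m b g \<in> coboundaries C D (n + m)"
proof (cases n)
  case 0
  then show ?thesis
    using b g cupc_one_left[of g m 0] subgroup.one_closed[OF subgroup_coboundaries[of m]]
    by (simp add: coboundaries_def[of _ _ 0] cocycles_iff)
next
  case (Suc k)
  then obtain a where a: "a \<in> carrier (F k)" "b = \<delta> k a"
    using b by (auto simp: coboundaries_def)
  then show ?thesis
    using cupc_cocycle_right[OF a(1) g] coboundaryI[OF cupc_closed[of a k g m]] g
    by (simp add: Suc cocycles_iff)
qed

lemma cupc_coboundary_right:
  assumes f: "f \<in> cocycles C D n" and b: "b \<in> coboundaries C D m"
  shows "cupc n m f b \<in> coboundaries C D (n + m)"
proof (cases m)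
  case 0
  then show ?thesis
    using b f cupc_one_right[of f n 0] subgroup.one_closed[OF subgroup_coboundaries[of n]]
    by (simp add: coboundaries_def[of _ _ 0] cocycles_iff)
next
  case (Suc k)
  then obtain a where a: "a \<in> carrier (F k)" "b = \<delta> k a"
    using b by (auto simp: coboundaries_def)
  have fF: "f \<in> carrier (F n)" using f by (simp add: cocycles_iff)
  let ?c = "cupc n k f a" and ?e = "cupc n (Suc k) f (\<delta> k a)"
  have c: "?c \<in> carrier (F (n + k))" and e: "?e \<in> carrier (F (Suc (n + k)))"
    using cupc_closed[OF fF a(1)] cupc_closed[OF fF, of "\<delta> k a" "Suc k"] a by auto
  \<comment> \<open>The sign \<open>(-1)^n\<close> of the Leibniz rule remains. Either way the
    product is a coboundary, since coboundaries are closed under inverses.\<close>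
  have "?e = \<delta> (n + k) ?c \<or> ?e = inv\<^bsub>F (Suc (n + k))\<^esub> \<delta> (n + k) ?c"
  proof (cases "even n")
    case True
    have "?e = \<delta> (n + k) ?c"
    proof (rule cochain_eqI[OF e delta_closed[OF c]])
      fix \<sigma> assume \<sigma>: "\<sigma> \<in> chains_of C (Suc (n + k))"
      interpret G: comm_group "Gr D (composite C \<sigma>)" by (rule comm_group_composite[OF \<sigma>])
      show "?e \<sigma> = \<delta> (n + k) ?c \<sigma>"
        using True cochain_closed[OF e \<sigma>] by (simp add: cupc_cocycle_left[OF f a(1) \<sigma>])
    qed
    then show ?thesis ..
  next
    case False
    have "?e = inv\<^bsub>F (Suc (n + k))\<^esub> \<delta> (n + k) ?c"
    proof (rule cochain_eqI[OF e F.inv_closed[OF delta_closed[OF c]]])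
      fix \<sigma> assume \<sigma>: "\<sigma> \<in> chains_of C (Suc (n + k))"
      interpret G: comm_group "Gr D (composite C \<sigma>)" by (rule comm_group_composite[OF \<sigma>])
      show "?e \<sigma> = (inv\<^bsub>F (Suc (n + k))\<^esub> \<delta> (n + k) ?c) \<sigma>"
        using False cochain_closed[OF e \<sigma>]
        by (simp add: cochain_inv_apply[OF delta_closed[OF c] \<sigma>] cupc_cocycle_left[OF f a(1) \<sigma>]
            G.int_pow_neg)
    qed
    then show ?thesis ..
  qed
  then show ?thesis
    using coboundaryI[OF c] subgroup.m_inv_closed[OF subgroup_coboundaries, of "\<delta> (n + k) ?c" "Suc (n + k)"]
    by (auto simp: Suc a)
qed

text \<open>Written additively with \<open>f' = a + f\<close> and \<open>g' = b + g\<close>, the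
  product is \<open>a g' + f b + f g\<close>. The first two terms are coboundaries, the first
  because \<open>g'\<close> is again a cocycle.\<close>

lemma cohomology_class_cupc_cong:
  assumes f: "f \<in> cocycles C D n" and g: "g \<in> cocycles C D m"
    and f': "f' \<in> cohomology_class C D n f" and g': "g' \<in> cohomology_class C D m g"
  shows "cohomology_class C D (n + m) (cupc n m f' g') = cohomology_class C D (n + m) (cupc n m f g)"
proof -
  obtain a b where a: "a \<in> coboundaries C D n" "f' = a \<otimes>\<^bsub>F n\<^esub> f"
    and b: "b \<in> coboundaries C D m" "g' = b \<otimes>\<^bsub>F m\<^esub> g"
    using f' g' by (auto simp: cohomology_class_iff)
  have g'c: "g' \<in> cocycles C D m"
    unfolding b(2) by (intro subgroup.m_closed[OF subgroup_cocycles] coboundary_cocycle b g)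
  have mem: "a \<in> carrier (F n)" "b \<in> carrier (F m)" "f \<in> carrier (F n)" "g \<in> carrier (F m)" "g' \<in> carrier (F m)"
    using a b f g g'c by (auto simp: cocycles_iff coboundaries_closed)
  have "cupc n m f' g' = cupc n m a g' \<otimes>\<^bsub>F (n + m)\<^esub> cupc n m f g'"
    unfolding a by (rule cupc_mult_left) (use mem in auto)
  moreover have "cupc n m f g' = cupc n m f b \<otimes>\<^bsub>F (n + m)\<^esub> cupc n m f g"
    unfolding b by (rule cupc_mult_right) (use mem in auto)
  ultimately show ?thesis
    using cupc_coboundary_left[OF a(1) g'c] cupc_coboundary_right[OF f b(1)] mem
    by (simp add: cohomology_class_mult cupc_closed)
qed

text \<open>The union defining \<open>cup\<close> runs over nonempty classes and all its members
  coincide, so it collapses to one class and computations may use any chosen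
  representatives.\<close>

lemma cup_cohomology_class:
  assumes f: "f \<in> cocycles C D n" and g: "g \<in> cocycles C D m"
  shows "cup C D \<mu> (n, cohomology_class C D n f) (m, cohomology_class C D m g) =
    (n + m, cohomology_class C D (n + m) (cupc n m f g))"
proof -
  let ?X = "cohomology_class C D n f" and ?Y = "cohomology_class C D m g"
  have "f \<in> ?X" "g \<in> ?Y"
    using f g by (simp_all add: self_cohomology_class cocycles_iff)
  moreover have "(\<Union>f'\<in>?X. \<Union>g'\<in>?Y. cohomology_class C D (n + m) (cupc n m f' g')) =
      (\<Union>f'\<in>?X. \<Union>g'\<in>?Y. cohomology_class C D (n + m) (cupc n m f g))"
    by (intro SUP_cong refl cohomology_class_cupc_cong[OF f g])
  ultimately show ?thesis by (auto simp: cup_def)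
qed

end

section \<open>Functoriality and relative classes\<close>


lemma is_functorD:
  assumes "is_functor C C' F"
  shows "A \<in> Obj C \<Longrightarrow> FObj F A \<in> Obj C'"
    and "f \<in> Arr C \<Longrightarrow> FArr F f \<in> Arr C'"
    and "f \<in> Arr C \<Longrightarrow> Dom C' (FArr F f) = FObj F (Dom C f)"
    and "f \<in> Arr C \<Longrightarrow> Cod C' (FArr F f) = FObj F (Cod C f)"
    and "A \<in> Obj C \<Longrightarrow> FArr F (Ident C A) = Ident C' (FObj F A)"
    and "f \<in> Arr C \<Longrightarrow> g \<in> Arr C \<Longrightarrow> Dom C g = Cod C f \<Longrightarrow>
      FArr F (g \<bullet>\<^bsub>C\<^esub> f) = FArr F g \<bullet>\<^bsub>C'\<^esub> FArr F f"
  using assms by (auto simp: is_functor_def Hom_def)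

locale category_functor = C: category C + C': category C'
  for C :: "('o, 'm) cat" and C' :: "('p, 'q) cat" +
  fixes F
  assumes is_functor: "is_functor C C' F"
begin

lemmas functor_simps [simp] = is_functorD[OF is_functor]

context
  fixes \<sigma> N
  assumes \<sigma>: "\<sigma> \<in> chains_of C N"
begin

interpretation category_chain C \<sigma> N by unfold_locales (rule \<sigma>)

lemma vertex_map_chain: "i \<le> N \<Longrightarrow> vertex C' (map_chain F \<sigma>) i = FObj F (vertex C \<sigma> i)"
  by (auto simp: vertex_def map_chain_def arr_nth)

lemma map_chain_chains: "map_chain F \<sigma> \<in> chains_of C' N"
  using vertex_map_chain \<sigma>
  by (auto simp: chains_of_iff C.category_axioms C'.category_axioms)
    (auto simp: map_chain_def)

lemma segment_map_chain:
  assumes "i \<le> j" "j \<le> N"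
  shows "segment C' (map_chain F \<sigma>) i j = FArr F (segment C \<sigma> i j)"
proof -
  interpret m: category_chain C' "map_chain F \<sigma>" N
    by unfold_locales (rule map_chain_chains)
  show ?thesis
    using assms
  proof (induction rule: inc_induct)
    case base
    then show ?case by (simp add: m.segment_refl segment_refl vertex_map_chain)
  next
    case (step k)
    then have "snd (map_chain F \<sigma>) ! k = FArr F (snd \<sigma> ! k)" by (simp add: map_chain_def)
    with step show ?case by (simp add: m.segment_step segment_step arr_nth Dom_nth)
  qed
qed

lemma composite_map_chain: "composite C' (map_chain F \<sigma>) = FArr F (composite C \<sigma>)"
proof -
  interpret m: category_chain C' "map_chain F \<sigma>" N
    by unfold_locales (rule map_chain_chains)
  show ?thesis by (simp add: m.composite_eq_segment composite_eq_segment segment_map_chain)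
qed

lemma reindex_map_chain:
  assumes "mono \<theta>" "\<theta> m \<le> N"
  shows "reindex C' m \<theta> (map_chain F \<sigma>) = map_chain F (reindex C m \<theta> \<sigma>)"
  using \<theta>_le[OF assms]
  by (auto simp: reindex_def vertex_map_chain segment_map_chain map_chain_def[of _ "(_, _)"])

end

end

lemma natural_system_restrict_ns:
  assumes "category E" "category B" "is_functor E B P" "natural_system B D"
  shows "natural_system E (restrict_ns P D)"
proof -
  interpret category_functor E B P using assms by unfold_locales (auto simp: category_def)
  interpret category_natural_system B D using assms(4) by unfold_locales
  show ?thesis
    unfolding natural_system_def is_ab_functor_def
  proof (intro conjI ballI impI)
    fix l assume "l \<in> Obj (fact_cat E)"
    then show "comm_group (Gr (restrict_ns P D) l)"
      by (simp add: fact_cat_def restrict_ns_def fact_functor_def comm_group_Gr)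
  next
    fix k assume "k \<in> Arr (fact_cat E)"
    then show "Mp (restrict_ns P D) k \<in>
        hom (Gr (restrict_ns P D) (Dom (fact_cat E) k)) (Gr (restrict_ns P D) (Cod (fact_cat E) k))"
      using Mp_hom[of "FArr P (fst k)" "FArr P (fst (snd k))" "FArr P (snd (snd k))"]
      by (auto simp: fact_cat_def restrict_ns_def fact_functor_def)
  next
    fix l x assume "l \<in> Obj (fact_cat E)" "x \<in> carrier (Gr (restrict_ns P D) l)"
    then show "Mp (restrict_ns P D) (Ident (fact_cat E) l) x = x"
      using Mp_Ident[of "FArr P l" x] C.Dom_Obj[of l] C.Cod_Obj[of l]
      by (simp add: fact_cat_def restrict_ns_def fact_functor_def)
  next
    fix k k' x
    assume "k \<in> Arr (fact_cat E)" "k' \<in> Arr (fact_cat E)" "Dom (fact_cat E) k' = Cod (fact_cat E) k"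
      and "x \<in> carrier (Gr (restrict_ns P D) (Dom (fact_cat E) k))"
    then show "Mp (restrict_ns P D) (k' \<bullet>\<^bsub>fact_cat E\<^esub> k) x =
        Mp (restrict_ns P D) k' (Mp (restrict_ns P D) k x)"
      using Mp_Comp[of "FArr P (fst k)" "FArr P (fst (snd k))" "FArr P (snd (snd k))"
          "FArr P (fst (snd k'))" "FArr P (snd (snd k'))" x "FArr P (fst k')"]
      by (auto simp: fact_cat_def restrict_ns_def fact_functor_def)
  qed
qed

section \<open>Strict sections over a subcategory and vanishing representatives\<close>

lemma subcategory_functor: "subcategory U B \<Longrightarrow> is_functor U B inclusion"
  using category.Dom_Obj category.Cod_Obj
  by (fastforce simp: subcategory_def is_functor_def inclusion_def Hom_def)

locale category_section = category_natural_system B D + P: category_functor E B P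
  for E :: "('p, 'q) cat" and B :: "('o, 'm) cat" and D :: "('m, 'a) nat_sys" and P +
  fixes U s
  assumes sub: "subcategory U B" and s: "is_functor U E s"
    and strict: "functor_eq U (functor_comp P s) inclusion"
begin

sublocale U: category U
  using sub by (simp add: subcategory_def)

sublocale s: category_functor U E s
  using s by unfold_locales

text \<open>The records \<open>U\<close> and \<open>B\<close> agree only on the carriers of
  \<open>U\<close>, so segments and reindexed chains taken in one are formally different from those
  in the other. Viewing the inclusion as a functor turns each comparison into an instance of
  naturality.\<close>

sublocale i: category_functor U B inclusion
  using subcategory_functor[OF sub] by unfold_locales

sublocale R: category_natural_system E "restrict_ns P D"
  using natural_system natural_system_restrict_ns P.is_functor P.C.category_axioms category_axioms
  by unfold_locales blast

lemma P_s: "f \<in> Arr U \<Longrightarrow> FArr P (FArr s f) = f" "A \<in> Obj U \<Longrightarrow> FObj P (FObj s A) = A"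
  using strict by (auto simp: functor_eq_def functor_comp_def inclusion_def)

lemma map_chain_inclusion: "map_chain inclusion \<sigma> = \<sigma>"
  by (simp add: map_chain_def inclusion_def)

lemma map_chain_section:
  assumes "\<sigma> \<in> chains_of U n" shows "map_chain P (map_chain s \<sigma>) = \<sigma>"
proof -
  interpret category_chain U \<sigma> n by unfold_locales fact
  have "fst \<sigma> \<in> Obj U" "\<forall>f\<in>set (snd \<sigma>). f \<in> Arr U"
    using assms arr_nth by (auto simp: chains_of_iff[OF U.category_axioms] in_set_conv_nth)
  then show ?thesis by (auto simp: map_chain_def P_s prod_eq_iff intro: map_idI)
qed

lemma U_chains: "\<sigma> \<in> chains_of U n \<Longrightarrow> \<sigma> \<in> chains_of B n"
  using i.map_chain_chains by (simp add: map_chain_inclusion)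

lemma U_segment: "\<sigma> \<in> chains_of U n \<Longrightarrow> i \<le> j \<Longrightarrow> j \<le> n \<Longrightarrow>
    FArr P (segment E (map_chain s \<sigma>) i j) = segment B \<sigma> i j"
  using i.segment_map_chain[of \<sigma> n i j] s.segment_map_chain[of \<sigma> n i j]
    category_chain.segment_arr(1)[of U \<sigma> n i j]
  by (simp add: map_chain_inclusion P_s category_chain_def category_chain_axioms_def U.category_axioms)
    (simp add: inclusion_def)

lemma U_composite:
  assumes "\<sigma> \<in> chains_of U n" shows "FArr P (composite E (map_chain s \<sigma>)) = composite B \<sigma>"
proof -
  interpret b: category_chain B \<sigma> n by unfold_locales (rule U_chains[OF assms])
  interpret e: category_chain E "map_chain s \<sigma>" n by unfold_locales (rule s.map_chain_chains[OF assms])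
  show ?thesis using U_segment[OF assms, of 0 n] by (simp add: b.composite_eq_segment e.composite_eq_segment)
qed

text \<open>Closure of \<open>U\<close> under composition keeps faces and front and back pieces
  inside \<open>U\<close>. Both the extension by zero and the vanishing of products depend on
  it.\<close>

lemma U_reindex:
  assumes "\<sigma> \<in> chains_of U n" "mono \<theta>" "\<theta> m \<le> n"
  shows "reindex B m \<theta> \<sigma> \<in> chains_of U m"
    and "map_chain s (reindex B m \<theta> \<sigma>) = reindex E m \<theta> (map_chain s \<sigma>)"
proof -
  interpret category_chain U \<sigma> n by unfold_locales fact
  have "reindex B m \<theta> \<sigma> = reindex U m \<theta> \<sigma>"
    using i.reindex_map_chain[OF assms] by (simp add: map_chain_inclusion)
  then show "reindex B m \<theta> \<sigma> \<in> chains_of U m"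
    "map_chain s (reindex B m \<theta> \<sigma>) = reindex E m \<theta> (map_chain s \<sigma>)"
    using reindex_chain[OF assms(2,3)] s.reindex_map_chain[OF assms] by simp_all
qed

text \<open>The pullback of \<open>g\<close> along the section lives on chains of \<open>U\<close>
  only, whereas a correction term must be a cochain on all of \<open>B\<close>; the neutral element
  fills the remaining values.\<close>

definition zero_extension :: "nat \<Rightarrow> ('p, 'q, 'a) cochain \<Rightarrow> ('o, 'm, 'a) cochain" where
  "zero_extension n g = (\<lambda>\<tau>\<in>chains_of B n.
     if \<tau> \<in> chains_of U n then g (map_chain s \<tau>) else \<one>\<^bsub>Gr D (composite B \<tau>)\<^esub>)"

lemma Gr_restrict: "Gr (restrict_ns P D) l = Gr D (FArr P l)"
  by (simp add: restrict_ns_def fact_functor_def)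

lemma Mp_restrict: "Mp (restrict_ns P D) (l, \<alpha>, \<beta>) = Mp D (FArr P l, FArr P \<alpha>, FArr P \<beta>)"
  by (simp add: restrict_ns_def fact_functor_def)

lemma zero_extension_closed:
  assumes "g \<in> carrier (R.F n)" shows "zero_extension n g \<in> carrier (F n)"
proof -
  have "g (map_chain s \<tau>) \<in> carrier (Gr D (composite B \<tau>))" if "\<tau> \<in> chains_of U n" for \<tau>
    using R.cochain_closed[OF assms s.map_chain_chains[OF that]] by (simp add: Gr_restrict U_composite[OF that])
  moreover have "\<one>\<^bsub>Gr D (composite B \<tau>)\<^esub> \<in> carrier (Gr D (composite B \<tau>))" if "\<tau> \<in> chains_of B n" for \<tau>
    using group_composite[OF that] by (simp add: group.is_monoid)
  ultimately show ?thesis by (auto simp: cochain_group_carrier zero_extension_def)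
qed

text \<open>Every face of a chain of \<open>U\<close> lies in \<open>U\<close>, so the coboundary at
  such a chain sees only values of \<open>g\<close> taken through \<open>s\<close>, and the
  transports agree because \<open>P s\<close> is the identity.\<close>

lemma delta_zero_extension:
  assumes g: "g \<in> carrier (R.F n)" and \<sigma>: "\<sigma> \<in> chains_of U (Suc n)"
  shows "\<delta> n (zero_extension n g) \<sigma> = R.\<delta> n g (map_chain s \<sigma>)"
proof -
  have coact: "coact E (restrict_ns P D) n (coface i) g (map_chain s \<sigma>) =
      coact B D n (coface i) (zero_extension n g) \<sigma>" for i
  proof -
    have le: "mono (coface i)" "coface i n \<le> Suc n" "coface i 0 \<le> coface i n" "coface i 0 \<le> Suc n"
      by (auto simp: coface_le coface_def)
    have "length (snd (map_chain s \<sigma>)) = Suc n" "length (snd \<sigma>) = Suc n"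
      using \<sigma> by (auto simp: chains_of_def map_chain_def)
    then show ?thesis
      using U_reindex[OF \<sigma> le(1,2)] U_chains
      by (simp add: coact_def Mp_restrict U_segment[OF \<sigma>] le zero_extension_def)
  qed
  show ?thesis
    using delta_eq[OF zero_extension_closed[OF g] U_chains[OF \<sigma>]] R.delta_eq[OF g s.map_chain_chains[OF \<sigma>]]
    by (simp add: coact Gr_restrict U_composite[OF \<sigma>] del: comm_monoid.finprod_Suc)
qed

lemma vanishing_representative:
  assumes f: "f \<in> cocycles B D n" and n: "n \<ge> 1"
    and cob: "induced_cochain E P n f \<in> coboundaries E (restrict_ns P D) n"
  obtains f' where "f' \<in> cocycles B D n" "cohomology_class B D n f' = cohomology_class B D n f"
    "\<And>\<sigma>. \<sigma> \<in> chains_of U n \<Longrightarrow> f' \<sigma> = \<one>\<^bsub>Gr D (composite B \<sigma>)\<^esub>"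
proof -
  obtain k where k: "n = Suc k" using n by (cases n) auto
  obtain g where g: "g \<in> carrier (R.F k)" "induced_cochain E P n f = R.\<delta> k g"
    using cob by (auto simp: coboundaries_def k)
  let ?b = "\<delta> k (zero_extension k g)"
  have b: "?b \<in> coboundaries B D n" "inv\<^bsub>F n\<^esub> ?b \<in> coboundaries B D n"
    using coboundaryI[OF zero_extension_closed[OF g(1)]] subgroup.m_inv_closed[OF subgroup_coboundaries]
    by (auto simp: k)
  have fF: "f \<in> carrier (F n)" and bF: "?b \<in> carrier (F n)"
    using f b coboundaries_closed by (auto simp: cocycles_iff)
  \<comment> \<open>Strictness gives \<open>f \<sigma> = f (P (s \<sigma>))\<close>, which is the
    value of \<open>P^* f = \<delta> g\<close> on the chain \<open>s \<sigma>\<close>.\<close>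
  have eq: "f \<sigma> = ?b \<sigma>" if "\<sigma> \<in> chains_of U n" for \<sigma>
  proof -
    have "f \<sigma> = induced_cochain E P n f (map_chain s \<sigma>)"
      using s.map_chain_chains[OF that] by (simp add: induced_cochain_def map_chain_section[OF that])
    then show ?thesis using delta_zero_extension[OF g(1)] that g(2) by (simp add: k)
  qed
  show thesis
  proof (rule that)
    show "inv\<^bsub>F n\<^esub> ?b \<otimes>\<^bsub>F n\<^esub> f \<in> cocycles B D n"
      by (intro subgroup.m_closed[OF subgroup_cocycles] coboundary_cocycle b f)
    show "cohomology_class B D n (inv\<^bsub>F n\<^esub> ?b \<otimes>\<^bsub>F n\<^esub> f) = cohomology_class B D n f"
      by (intro cohomology_class_mult b fF)
    fix \<sigma> assume \<sigma>: "\<sigma> \<in> chains_of U n"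
    interpret G: comm_group "Gr D (composite B \<sigma>)" by (rule comm_group_composite[OF U_chains[OF \<sigma>]])
    show "(inv\<^bsub>F n\<^esub> ?b \<otimes>\<^bsub>F n\<^esub> f) \<sigma> = \<one>\<^bsub>Gr D (composite B \<sigma>)\<^esub>"
      using U_chains[OF \<sigma>] cochain_closed[OF bF U_chains[OF \<sigma>]]
      by (simp add: cochain_mult_apply cochain_inv_apply[OF bF] eq[OF \<sigma>])
  qed
qed

end

text \<open>Unpacks the kernel condition into a statement about one cocycle: its pullback lies in
  its own class, hence in the union defining \<open>induced\<close>, and the kernel condition
  equates that union with the coboundaries.\<close>

lemma ker_inducedE:
  assumes "category E" "category B" "is_functor E B P" "natural_system B D"
    and "(n, \<xi>) \<in> ker_induced E B P D"
  obtains f where "f \<in> cocycles B D n" "\<xi> = cohomology_class B D n f"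
    "induced_cochain E P n f \<in> coboundaries E (restrict_ns P D) n"
proof -
  interpret category_functor E B P using assms by unfold_locales (auto simp: category_def)
  interpret category_natural_system B D using assms(4) by unfold_locales
  interpret R: category_natural_system E "restrict_ns P D"
    using natural_system_restrict_ns[OF assms(1-4)] by unfold_locales
  have "\<xi> \<in> carrier (cohomology B D n)"
    and ker: "induced E P D n \<xi> = coboundaries E (restrict_ns P D) n"
    using assms(5) by (auto simp: ker_induced_def kernel_def R.one_cohomology)
  then obtain f where f: "f \<in> cocycles B D n" "\<xi> = cohomology_class B D n f"
    by (auto simp: carrier_cohomology)
  have "induced_cochain E P n f \<in> carrier (R.F n)"
  proof -
    have "f (map_chain P \<sigma>) \<in> carrier (Gr (restrict_ns P D) (composite E \<sigma>))" if "\<sigma> \<in> chains_of E n" for \<sigma>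
      using cochain_closed[of f n, OF _ map_chain_chains[OF that]] f
      by (simp add: cocycles_iff composite_map_chain[OF that] restrict_ns_def fact_functor_def)
    then show ?thesis by (auto simp: cochain_group_carrier induced_cochain_def)
  qed
  then have "induced_cochain E P n f \<in> cohomology_class E (restrict_ns P D) n (induced_cochain E P n f)"
    by (rule R.self_cohomology_class)
  then have "induced_cochain E P n f \<in> induced E P D n \<xi>"
    using self_cohomology_class[of f n] f by (auto simp: induced_def cocycles_iff)
  then show thesis using that f ker by simp
qed

section \<open>Lifting homotopies along bifibrations\<close>


lemma op_cat_simps [simp]:
  "Obj (op_cat C) = Obj C" "Arr (op_cat C) = Arr C" "Dom (op_cat C) = Cod C" "Cod (op_cat C) = Dom C"
  "Ident (op_cat C) = Ident C" "g \<bullet>\<^bsub>op_cat C\<^esub> f = f \<bullet>\<^bsub>C\<^esub> g"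
  by (simp_all add: op_cat_def)

lemma category_op_cat: "category C \<Longrightarrow> category (op_cat C)"
  by (auto simp: category_def Hom_def)

lemma is_functor_op_cat: "is_functor C D F \<Longrightarrow> is_functor (op_cat C) (op_cat D) F"
  by (auto simp: is_functor_def Hom_def)

lemma cartesianD:
  assumes "cartesian E B P \<phi>" "e \<in> Obj E" "\<beta> \<in> Hom E e (Cod E \<phi>)"
    and "\<alpha>' \<in> Hom B (FObj P e) (FObj P (Dom E \<phi>))" "FArr P \<phi> \<bullet>\<^bsub>B\<^esub> \<alpha>' = FArr P \<beta>"
  shows "\<exists>!\<alpha>. \<alpha> \<in> Hom E e (Dom E \<phi>) \<and> \<phi> \<bullet>\<^bsub>E\<^esub> \<alpha> = \<beta> \<and> FArr P \<alpha> = \<alpha>'"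
  using assms unfolding cartesian_def by blast

text \<open>A natural transformation \<eta> from \<open>K\<close> to \<open>P s\<close> is lifted
  componentwise to chosen Cartesian arrows ending at \<open>s A\<close>. Their domains are the
  objects of a functor \<open>s'\<close> strictly above \<open>K\<close>; existence in the universal
  property defines it on arrows, and uniqueness makes it preserve identities and composites.\<close>

lemma fibration_transport:
  assumes "category U" "category E" "category B" and fib: "fibration E B P"
    and s: "is_functor U E s" and K: "is_functor U B K"
    and \<eta>: "\<And>A. A \<in> Obj U \<Longrightarrow> \<eta> A \<in> Hom B (FObj K A) (FObj P (FObj s A))"
    and nat: "\<And>f. f \<in> Arr U \<Longrightarrow>
      \<eta> (Cod U f) \<bullet>\<^bsub>B\<^esub> FArr K f = FArr P (FArr s f) \<bullet>\<^bsub>B\<^esub> \<eta> (Dom U f)"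
  shows "\<exists>s'. is_functor U E s' \<and> functor_eq U (functor_comp P s') K"
proof -
  interpret U: category U by fact
  interpret E: category E by fact
  interpret B: category B by fact
  have P: "is_functor E B P" using fib by (simp add: fibration_def)
  note [simp] = is_functorD[OF P] is_functorD[OF s] is_functorD[OF K] U.Dom_Obj U.Cod_Obj E.Dom_Obj E.Cod_Obj
  have "\<exists>c. cartesian E B P c \<and> Cod E c = FObj s A \<and> FArr P c = \<eta> A" if "A \<in> Obj U" for A
  proof -
    have "FObj K A \<in> Obj B" "FObj P (FObj s A) \<in> Obj B" "FObj s A \<in> Obj E"
      using that by simp_all
    with fib \<eta>[OF that] have "\<exists>e1\<in>Obj E. \<exists>c\<in>Hom E e1 (FObj s A). cartesian E B P c \<and> FArr P c = \<eta> A"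
      unfolding fibration_def by blast
    then show ?thesis by (auto simp: Hom_def)
  qed
  then obtain c where c: "\<And>A. A \<in> Obj U \<Longrightarrow> cartesian E B P (c A)"
      "\<And>A. A \<in> Obj U \<Longrightarrow> Cod E (c A) = FObj s A" "\<And>A. A \<in> Obj U \<Longrightarrow> FArr P (c A) = \<eta> A"
    by metis
  have c_arr: "c A \<in> Arr E" if "A \<in> Obj U" for A
    using c(1)[OF that] by (simp add: cartesian_def)
  define e where "e A = Dom E (c A)" for A
  have e: "e A \<in> Obj E" "FObj P (e A) = FObj K A" if "A \<in> Obj U" for A
    using c_arr[OF that] c(3)[OF that] \<eta>[OF that] is_functorD(3)[OF P c_arr[OF that]]
    by (auto simp: e_def Hom_def)
  \<comment> \<open>Arrows above \<open>K f\<close> that complete the naturality square formed by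
    the Cartesian arrows and \<open>s f\<close>.\<close>
  define lifts where "lifts f \<alpha> \<longleftrightarrow> \<alpha> \<in> Hom E (e (Dom U f)) (e (Cod U f)) \<and>
    c (Cod U f) \<bullet>\<^bsub>E\<^esub> \<alpha> = FArr s f \<bullet>\<^bsub>E\<^esub> c (Dom U f) \<and> FArr P \<alpha> = FArr K f" for f \<alpha>
  \<comment> \<open>The compatibility in the base required by the universal property is exactly
    naturality of \<eta> at \<open>f\<close>.\<close>
  have ex1: "\<exists>!\<alpha>. lifts f \<alpha>" if f: "f \<in> Arr U" for f
    unfolding lifts_def e_def
    by (rule cartesianD[OF c(1)])
      (simp_all add: f c c_arr e[unfolded e_def] nat Hom_def)
  define a where "a f = (THE \<alpha>. lifts f \<alpha>)" for f
  have a: "lifts f (a f)" if "f \<in> Arr U" for f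
    unfolding a_def by (rule theI'[OF ex1[OF that]])
  have a_unique: "\<alpha> = a f" if "f \<in> Arr U" "lifts f \<alpha>" for f \<alpha>
    using ex1[OF that(1)] a[OF that(1)] that(2) by blast
  have a_arr: "a f \<in> Arr E" "Dom E (a f) = e (Dom U f)" "Cod E (a f) = e (Cod U f)"
      "c (Cod U f) \<bullet>\<^bsub>E\<^esub> a f = FArr s f \<bullet>\<^bsub>E\<^esub> c (Dom U f)" "FArr P (a f) = FArr K f"
    if "f \<in> Arr U" for f
    using a[OF that] by (auto simp: lifts_def Hom_def)
  define s' where "s' = \<lparr>FObj = e, FArr = a\<rparr>"
  have "is_functor U E s'"
    unfolding is_functor_def
  proof (intro conjI ballI impI)
    fix A assume A: "A \<in> Obj U"
    have "lifts (Ident U A) (Ident E (e A))"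
      using A e[OF A] c_arr[OF A] c(2)[OF A]
      by (simp add: lifts_def Hom_def E.Ident_left' E.Ident_right' e_def)
    then show "FArr s' (Ident U A) = Ident E (FObj s' A)"
      using a_unique[of "Ident U A"] A by (simp add: s'_def)
  next
    fix f g assume fg: "f \<in> Arr U" "g \<in> Arr U" "Dom U g = Cod U f"
    have "c (Cod U g) \<bullet>\<^bsub>E\<^esub> (a g \<bullet>\<^bsub>E\<^esub> a f) = (c (Cod U g) \<bullet>\<^bsub>E\<^esub> a g) \<bullet>\<^bsub>E\<^esub> a f"
      using fg a_arr c_arr by (intro E.Comp_assoc[symmetric]) (auto simp: e_def)
    also have "\<dots> = (FArr s g \<bullet>\<^bsub>E\<^esub> c (Cod U f)) \<bullet>\<^bsub>E\<^esub> a f"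
      using fg a_arr(4)[of g] by simp
    also have "\<dots> = FArr s g \<bullet>\<^bsub>E\<^esub> (c (Cod U f) \<bullet>\<^bsub>E\<^esub> a f)"
      using fg a_arr c_arr c(2) by (intro E.Comp_assoc) (auto simp: e_def)
    also have "\<dots> = FArr s g \<bullet>\<^bsub>E\<^esub> (FArr s f \<bullet>\<^bsub>E\<^esub> c (Dom U f))"
      using fg a_arr(4)[of f] by simp
    also have "\<dots> = (FArr s g \<bullet>\<^bsub>E\<^esub> FArr s f) \<bullet>\<^bsub>E\<^esub> c (Dom U f)"
      using fg a_arr c_arr c(2) by (intro E.Comp_assoc[symmetric]) auto
    finally have "lifts (g \<bullet>\<^bsub>U\<^esub> f) (a g \<bullet>\<^bsub>E\<^esub> a f)"
      using fg a_arr[OF fg(1)] a_arr[OF fg(2)] by (simp add: lifts_def Hom_def)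
    then show "FArr s' (g \<bullet>\<^bsub>U\<^esub> f) = FArr s' g \<bullet>\<^bsub>E\<^esub> FArr s' f"
      using a_unique[of "g \<bullet>\<^bsub>U\<^esub> f"] fg by (simp add: s'_def)
  qed (use e a_arr in \<open>auto simp: s'_def Hom_def\<close>)
  moreover have "functor_eq U (functor_comp P s') K"
    using e a_arr by (simp add: functor_eq_def functor_comp_def s'_def)
  ultimately show ?thesis by blast
qed

text \<open>Each arrow of the zigzag is a natural transformation between adjacent levels of
  \<open>H\<close>. A strict lift of level \<open>0\<close> is \<open>s\<close> itself, and the
  induction moves it to a strict lift of level \<open>m\<close>.\<close>

lemma bifibration_homotopy_lift:
  assumes "category U" "category E" "category B" and bifib: "bifibration E B P"
    and s: "is_functor U E s" and hom: "homotopic U B (functor_comp P s) G"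
  shows "\<exists>s'. is_functor U E s' \<and> functor_eq U (functor_comp P s') G"
proof -
  interpret U: category U by fact
  interpret B: category B by fact
  obtain m H where H: "is_functor (prod_cat U (zigzag m)) B H"
    and H0: "functor_eq U (level H 0) (functor_comp P s)" and Hm: "functor_eq U (level H m) G"
    using hom by (auto simp: homotopic_def)
  have H_obj: "FObj H (A, i) \<in> Obj B" if "A \<in> Obj U" "i \<le> m" for A i
    using is_functorD(1)[OF H, of "(A, i)"] that by (simp add: prod_cat_def zigzag_def)
  have H_arr: "FArr H (f, (i, j)) \<in> Hom B (FObj H (Dom U f, i)) (FObj H (Cod U f, j))"
    if "f \<in> Arr U" "(i, j) \<in> Arr (zigzag m)" for f i j
    using is_functorD(2,3,4)[OF H, of "(f, (i, j))"] that
    by (simp add: prod_cat_def zigzag_def Hom_def)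
  have H_comp: "FArr H (g \<bullet>\<^bsub>U\<^esub> f, (i, k)) = FArr H (g, (j, k)) \<bullet>\<^bsub>B\<^esub> FArr H (f, (i, j))"
    if "f \<in> Arr U" "g \<in> Arr U" "Dom U g = Cod U f" "(i, j) \<in> Arr (zigzag m)" "(j, k) \<in> Arr (zigzag m)"
    for f g i j k
    using is_functorD(6)[OF H, of "(f, (i, j))" "(g, (j, k))"] that
    by (simp add: prod_cat_def zigzag_def)
  have level: "is_functor U B (level H j)" if "j \<le> m" for j
    using that H_obj H_arr[of _ j j] H_comp[of _ _ j j j] is_functorD(5)[OF H, of "(_, j)"]
    by (simp add: is_functor_def level_def prod_cat_def zigzag_def)
  \<comment> \<open>Both composites are the value of \<open>H\<close> on the diagonal arrow
    \<open>(f, (i, j))\<close> of the product category.\<close>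
  have natural: "FArr H (Ident U (Cod U f), (i, j)) \<bullet>\<^bsub>B\<^esub> FArr H (f, (i, i)) =
      FArr H (f, (j, j)) \<bullet>\<^bsub>B\<^esub> FArr H (Ident U (Dom U f), (i, j))"
    if "f \<in> Arr U" "(i, j) \<in> Arr (zigzag m)" for f i j
  proof -
    have "(i, i) \<in> Arr (zigzag m)" "(j, j) \<in> Arr (zigzag m)" using that by (auto simp: zigzag_def)
    then show ?thesis
      using that H_comp[of f "Ident U (Cod U f)" i i j] H_comp[of "Ident U (Dom U f)" f i j j]
        U.Dom_Obj[of f] U.Cod_Obj[of f]
      by (simp add: U.Ident_left U.Ident_right)
  qed
  have "\<exists>s'. is_functor U E s' \<and> functor_eq U (functor_comp P s') (level H j)" if "j \<le> m" for j
    using that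
  proof (induction j)
    case 0
    then show ?case using s H0 by (auto simp: functor_eq_def)
  next
    case (Suc j)
    then obtain t where t: "is_functor U E t" "functor_eq U (functor_comp P t) (level H j)" by auto
    have t_obj: "FObj P (FObj t A) = FObj H (A, j)" if "A \<in> Obj U" for A
      using t(2) that by (simp add: functor_eq_def functor_comp_def level_def)
    have t_arr: "FArr P (FArr t f) = FArr H (f, (j, j))" if "f \<in> Arr U" for f
      using t(2) that by (simp add: functor_eq_def functor_comp_def level_def)
    show ?case
    proof (cases "even j")
      case True
      then have z: "(j, Suc j) \<in> Arr (zigzag m)" using Suc.prems by (simp add: zigzag_def)
      \<comment> \<open>For even \<open>j\<close> the transformation starts at \<open>P t\<close>.
        In the opposite categories it ends there, as the transport lemma demands, and the
        op-fibration provides the lifts; the resulting functor record serves the original categories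
        unchanged.\<close>
      have "\<exists>s'. is_functor (op_cat U) (op_cat E) s' \<and>
          functor_eq (op_cat U) (functor_comp P s') (level H (Suc j))"
      proof (rule fibration_transport[where \<eta> = "\<lambda>A. FArr H (Ident U A, (j, Suc j))"])
        show "fibration (op_cat E) (op_cat B) P"
          using bifib by (simp add: bifibration_def op_fibration_def)
        show "FArr H (Ident U A, (j, Suc j)) \<in>
            Hom (op_cat B) (FObj (level H (Suc j)) A) (FObj P (FObj t A))" if "A \<in> Obj (op_cat U)" for A
          using H_arr[OF _ z, of "Ident U A"] that t_obj by (simp add: Hom_def level_def)
        show "FArr H (Ident U (Cod (op_cat U) f), (j, Suc j)) \<bullet>\<^bsub>op_cat B\<^esub> FArr (level H (Suc j)) f =
            FArr P (FArr t f) \<bullet>\<^bsub>op_cat B\<^esub> FArr H (Ident U (Dom (op_cat U) f), (j, Suc j))"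
          if "f \<in> Arr (op_cat U)" for f
          using natural[OF _ z, of f] that t_arr by (simp add: level_def)
      qed (use assms level[OF Suc.prems] t in \<open>auto intro: category_op_cat is_functor_op_cat\<close>)
      then show ?thesis by (auto simp: is_functor_def functor_eq_def Hom_def)
    next
      case False
      then have z: "(Suc j, j) \<in> Arr (zigzag m)" using Suc.prems by (simp add: zigzag_def)
      show ?thesis
      \<comment> \<open>For odd \<open>j\<close> the zigzag arrow runs from \<open>j + 1\<close> to
        \<open>j\<close>, so the transformation already ends at \<open>P t\<close>.\<close>
      proof (rule fibration_transport[where \<eta> = "\<lambda>A. FArr H (Ident U A, (Suc j, j))"])
        show "fibration E B P" using bifib by (simp add: bifibration_def)
        show "FArr H (Ident U A, (Suc j, j)) \<in> Hom B (FObj (level H (Suc j)) A) (FObj P (FObj t A))"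
          if "A \<in> Obj U" for A
          using H_arr[OF _ z, of "Ident U A"] that t_obj by (simp add: level_def)
        show "FArr H (Ident U (Cod U f), (Suc j, j)) \<bullet>\<^bsub>B\<^esub> FArr (level H (Suc j)) f =
            FArr P (FArr t f) \<bullet>\<^bsub>B\<^esub> FArr H (Ident U (Dom U f), (Suc j, j))"
          if "f \<in> Arr U" for f
          using natural[OF that z] t_arr[OF that] by (simp add: level_def)
      qed (use assms level[OF Suc.prems] t in auto)
    qed
  qed
  from this[of m] show ?thesis using Hm by (auto simp: functor_eq_def)
qed

section \<open>The cup-length estimate\<close>

theorem theorem2p20:
  fixes E :: "('p, 'q) cat" and B :: "('o, 'm) cat" and P :: "('p, 'q, 'o, 'm) ftor"
    and D :: "('m, 'a) nat_sys" and \<mu> :: "'m \<Rightarrow> 'm \<Rightarrow> 'a \<Rightarrow> 'a \<Rightarrow> 'a"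
  assumes "category E" and "category B" and "bifibration E B P"
    and "natural_system B D" and "endopairing B D \<mu>"
  shows "cup_length B D \<mu> (ker_induced E B P D) \<le> svarc_genus E B P"
  unfolding svarc_genus_def
proof (rule INF_greatest)
  interpret E: category E by fact
  interpret category_endopairing B D \<mu>
    using assms by (simp add: category_endopairing_def category_natural_system_def
        category_natural_system_axioms_def category_endopairing_axioms_def)
  have P: "is_functor E B P" using assms(3) by (simp add: bifibration_def fibration_def)
  fix n assume "n \<in> {n. \<exists>U s. geometric_cover B n U \<and>
     (\<forall>i\<le>n. is_functor (U i) E (s i) \<and> homotopic (U i) B (functor_comp P (s i)) inclusion)}"
  then obtain U s0 where cover: "geometric_cover B n U"
    and s0: "\<And>i. i \<le> n \<Longrightarrow> is_functor (U i) E (s0 i)"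
      "\<And>i. i \<le> n \<Longrightarrow> homotopic (U i) B (functor_comp P (s0 i)) inclusion"
    by blast
  have sub: "subcategory (U i) B" if "i \<le> n" for i using cover that by (simp add: geometric_cover_def)
  have "\<exists>s. is_functor (U i) E s \<and> functor_eq (U i) (functor_comp P s) inclusion" if "i \<le> n" for i
    using sub[OF that] s0[OF that] assms
    by (intro bifibration_homotopy_lift) (auto simp: subcategory_def)
  then obtain s where s: "\<And>i. i \<le> n \<Longrightarrow> category_section E B D P (U i) (s i)"
    using sub P assms category_natural_system_axioms
    by (metis category_section.intro category_section_axioms.intro category_functor.intro
        category_functor_axioms.intro)
  \<comment> \<open>The index \<open>i\<close> will be the position of the factor in the product.
    Vanishing is claimed only for \<open>i \<le> n\<close>, so that later factors are covered by the
    same statement.\<close>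
  have rep: "\<exists>f\<in>cocycles B D d. \<xi> = cohomology_class B D d f \<and>
      (i \<le> n \<longrightarrow> (\<forall>\<sigma>\<in>chains_of (U i) d. f \<sigma> = \<one>\<^bsub>Gr D (composite B \<sigma>)\<^esub>))"
    if ker: "(d, \<xi>) \<in> ker_induced E B P D" and d: "1 \<le> d" for d \<xi> i
  proof -
    obtain f where f: "f \<in> cocycles B D d" "\<xi> = cohomology_class B D d f"
      "induced_cochain E P d f \<in> coboundaries E (restrict_ns P D) d"
      using ker_inducedE[OF assms(1,2) P assms(4) ker] .
    show ?thesis
    proof (cases "i \<le> n")
      case True
      then interpret S: category_section E B D P "U i" "s i" by (rule s)
      show ?thesis using S.vanishing_representative[OF f(1) d f(3)] f(2) by metis
    qed (use f in auto)
  qed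
  \<comment> \<open>The invariant records one cocycle vanishing on all members of the cover used so
    far. Iterated products are bracketed from the left, so the list grows at its right end and the
    new factor has position \<open>length xs\<close>.\<close>
  have prod: "\<exists>d. \<exists>z\<in>cocycles B D d. cup_list B D \<mu> xs = (d, cohomology_class B D d z) \<and>
      (\<forall>i<length xs. i \<le> n \<longrightarrow> (\<forall>\<sigma>\<in>chains_of (U i) d. z \<sigma> = \<one>\<^bsub>Gr D (composite B \<sigma>)\<^esub>))"
    if "xs \<noteq> []" "set xs \<subseteq> ker_induced E B P D" "\<forall>x\<in>set xs. 1 \<le> fst x" for xs
    using that
  proof (induction xs rule: rev_nonempty_induct)
    case (single x)
    moreover obtain d \<xi> where "x = (d, \<xi>)" by (cases x)
    ultimately show ?case using rep[of d \<xi> 0] by (auto simp: cup_list_def)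
  next
    case (snoc x xs)
    then obtain d z where z: "z \<in> cocycles B D d" "cup_list B D \<mu> xs = (d, cohomology_class B D d z)"
      "\<And>i \<sigma>. i < length xs \<Longrightarrow> i \<le> n \<Longrightarrow> \<sigma> \<in> chains_of (U i) d \<Longrightarrow> z \<sigma> = \<one>\<^bsub>Gr D (composite B \<sigma>)\<^esub>"
      by auto
    obtain m \<xi> where x: "x = (m, \<xi>)" by (cases x)
    then obtain f where f: "f \<in> cocycles B D m" "\<xi> = cohomology_class B D m f"
      "\<And>\<sigma>. length xs \<le> n \<Longrightarrow> \<sigma> \<in> chains_of (U (length xs)) m \<Longrightarrow> f \<sigma> = \<one>\<^bsub>Gr D (composite B \<sigma>)\<^esub>"
      using rep[of m \<xi> "length xs"] snoc.prems by auto
    have "cup_list B D \<mu> (xs @ [x]) = cup B D \<mu> (cup_list B D \<mu> xs) x"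
      using snoc.hyps by (simp add: cup_list_def)
    also have "\<dots> = (d + m, cohomology_class B D (d + m) (cupc d m z f))"
      unfolding z(2) x f(2) by (rule cup_cohomology_class[OF z(1) f(1)])
    finally have cup: "cup_list B D \<mu> (xs @ [x]) = (d + m, cohomology_class B D (d + m) (cupc d m z f))" .
    have "cupc d m z f \<sigma> = \<one>\<^bsub>Gr D (composite B \<sigma>)\<^esub>"
      if i: "i \<le> length xs" "i \<le> n" and \<sigma>: "\<sigma> \<in> chains_of (U i) (d + m)" for i \<sigma>
    proof -
      interpret S: category_section E B D P "U i" "s i" using i by (intro s)
      have \<sigma>B: "\<sigma> \<in> chains_of B (d + m)" by (rule S.U_chains[OF \<sigma>])
      interpret category_chain B \<sigma> "d + m" by unfold_locales (rule \<sigma>B)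
      let ?l = "segment B \<sigma> 0 d" and ?r = "segment B \<sigma> d (d + m)"
      let ?x = "z (reindex B d (\<lambda>k. k) \<sigma>)" and ?y = "f (reindex B m ((+) d) \<sigma>)"
      have zf: "z \<in> carrier (F d)" "f \<in> carrier (F m)"
        using z f by (auto simp: cocycles_iff)
      have x: "?x \<in> carrier (Gr D ?l)" and y: "?y \<in> carrier (Gr D ?r)"
        using cochain_reindex[OF \<sigma>B zf(1) mono_id] cochain_reindex[OF \<sigma>B zf(2) mono_add, of d] by simp_all
      have G: "Gr D (?l \<bullet>\<^bsub>B\<^esub> ?r) = Gr D (composite B \<sigma>)"
        by (simp add: segment_comp composite_eq_segment)
      have groups: "group (Gr D ?l)" "group (Gr D ?r)" "group (Gr D (composite B \<sigma>))"
        using comm_group_Gr[of ?l] comm_group_Gr[of ?r] group_composite[OF \<sigma>B]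
        by (auto simp: comm_group_def)
      \<comment> \<open>For \<open>i < length xs\<close> the old product vanishes on the front
        piece; for \<open>i = length xs\<close> the new factor vanishes on the back piece.
        Biadditivity then kills the value.\<close>
      have "\<mu> ?l ?r ?x ?y = \<one>\<^bsub>Gr D (composite B \<sigma>)\<^esub>"
      proof (cases "i < length xs")
        case True
        have "?x = \<one>\<^bsub>Gr D ?l\<^esub>"
          using z(3)[OF True i(2), of "reindex B d (\<lambda>k. k) \<sigma>"] S.U_reindex(1)[OF \<sigma> mono_id, of d]
            composite_reindex[OF mono_id, of d] by simp
        then show ?thesis
          using pairing_left_hom[of ?l ?r ?y] y hom_one[of "\<lambda>x. \<mu> ?l ?r x ?y" "Gr D ?l" "Gr D (composite B \<sigma>)"] groups
          by (simp add: G)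
      next
        case False
        then have "i = length xs" using i by simp
        then have "?y = \<one>\<^bsub>Gr D ?r\<^esub>"
          using f(3)[of "reindex B m ((+) d) \<sigma>"] i S.U_reindex(1)[OF \<sigma> mono_add, of d m]
            composite_reindex[OF mono_add, of d m] by simp
        then show ?thesis
          using pairing_right_hom[of ?l ?r ?x] x hom_one[of "\<mu> ?l ?r ?x" "Gr D ?r" "Gr D (composite B \<sigma>)"] groups
          by (simp add: G)
      qed
      then show ?thesis by (simp add: cupc_apply[OF \<sigma>B refl])
    qed
    then show ?case
      using cup cupc_cocycles[OF z(1) f(1)] by (auto simp: less_Suc_eq_le)
  qed
  show "cup_length B D \<mu> (ker_induced E B P D) \<le> enat n"
    unfolding cup_length_def
  proof (rule SUP_least)
    fix N assume "N \<in> {N. N \<ge> 1 \<and>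
     (\<exists>xs. length xs = N \<and> set xs \<subseteq> ker_induced E B P D \<and> (\<forall>x\<in>set xs. fst x \<ge> 1) \<and>
        (let (d, \<zeta>) = cup_list B D \<mu> xs in \<zeta> \<noteq> \<one>\<^bsub>cohomology B D d\<^esub>))}"
    then obtain xs where xs: "length xs = N" "N \<ge> 1" "set xs \<subseteq> ker_induced E B P D"
      "\<forall>x\<in>set xs. 1 \<le> fst x" "let (d, \<zeta>) = cup_list B D \<mu> xs in \<zeta> \<noteq> \<one>\<^bsub>cohomology B D d\<^esub>"
      by blast
    have "xs \<noteq> []" using xs(1,2) by auto
    then obtain d z where z: "z \<in> cocycles B D d" "cup_list B D \<mu> xs = (d, cohomology_class B D d z)"
      "\<And>i \<sigma>. i < N \<Longrightarrow> i \<le> n \<Longrightarrow> \<sigma> \<in> chains_of (U i) d \<Longrightarrow> z \<sigma> = \<one>\<^bsub>Gr D (composite B \<sigma>)\<^esub>"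
      using prod[OF _ xs(3,4)] xs(1) by blast
    show "enat N \<le> enat n"
    proof (rule ccontr)
      assume "\<not> enat N \<le> enat n"
      \<comment> \<open>With more than \<open>n\<close> factors every cover index
        \<open>i \<le> n\<close> is the position of some factor, so the representing cocycle
        vanishes on every chain of \<open>B\<close>.\<close>
      then have "n < N" by simp
      have "z = \<one>\<^bsub>F d\<^esub>"
      proof (rule cochain_eqI[of _ B D d])
        fix \<sigma> assume \<sigma>: "\<sigma> \<in> chains_of B d"
        then obtain i where "i \<le> n" "\<sigma> \<in> chains_of (U i) d"
          using cover unfolding geometric_cover_def by blast
        then show "z \<sigma> = \<one>\<^bsub>F d\<^esub> \<sigma>"
          using z(3)[of i \<sigma>] \<open>n < N\<close> \<sigma> by (simp add: cochain_one_apply)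
      qed (use z in \<open>auto simp: cocycles_iff\<close>)
      then show False using xs(5) z(2) by (simp add: cohomology_class_one one_cohomology)
    qed
  qed
qed

end
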